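(* Let $\rho\in(0,2]$ and $\nu\in[0,1]$, and let $X,Y,Z\in\mathbb{B}(\mathcal{H})$ be such that $Z$ is positive. The following properties hold: (i) $\Delta_{(\rho,\nu)}(X+Y)\leq \Delta_{(\rho,\nu)}(X)+\Delta_{(\rho,\nu)}(Y)$. (ii) $\Delta_{(\rho,\nu)}(tX)=|t|\,\Delta_{(\rho,\nu)}(X)$ for any $t\in\mathbb{R}$. (iii) $\Delta_{(\rho,\nu)}(X)>0$ if $X\neq 0$. (iv) $\Delta_{(\rho,\nu)}(U^*XU)=\Delta_{(\rho,\nu)}(X)$ for any unitary $U\in\mathbb{B}(\mathcal{H})$. (v) $\Delta_{(\rho,\nu)}(Y^*XY)\leq \|Y\|^2\,\Delta_{(\rho,\nu)}(X)$. (vi) $\Delta_{(\rho,\nu)}(Z^sXZ^s)\leq \Delta_{(\rho,\nu)}(ZXZ)^{s}\,\Delta_{(\rho,\nu)}(X)^{1-s}$ for any $s\in[0,1]$. (vii) $\lim_{\rho\to 0}\rho\,\Delta_{(\rho,\nu)}(X)=2\,w\left(X+(1-2\nu)X^*\right)$.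
   Context: $\mathbb{B}(\mathcal{H})$ is the $C^*$-algebra of bounded linear operators on a complex Hilbert space $\mathcal{H}$, and $\|\cdot\|$ is the operator norm. For a bounded operator $A$ on a complex Hilbert space, $w(A)=\sup_{\|z\|=1}|\langle Az,z\rangle|$ is the numerical radius. For $\rho\in(0,2]$ and $\nu\in[0,1]$ put $\alpha=\sqrt{8\rho^{-1}-4}$ and $\beta=2\rho^{-1}-2$, and for $X\in\mathbb{B}(\mathcal{H})$ define $$\Delta_{(\rho,\nu)}(X)=w\left(\begin{bmatrix}0&\alpha X\\ \alpha(1-2\nu)X^*&\beta\left(X+(1-2\nu)X^*\right)\end{bmatrix}\right),$$ where the $2\times2$ operator matrix acts on $\mathcal{H}\oplus\mathcal{H}$. Positive means positive semidefinite. Conventions in (vi): $Z^0=I$ (the identity operator) and $0^0=1$. In (vii), the limit is over $\rho\in(0,2]$ tending to $0$.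
   Formalization: Property (iii) is stated only when (ρ,ν) is not (2,0) or (2,1): there Δ(X) is w(X+X* ) resp. w(X−X* ), which vanishes for X = iI resp. X = I, so (iii) as printed fails. *)

theory Defs
  imports "HOL-Analysis.Analysis" "HOL-Computational_Algebra.Polynomial"
begin

section \<open>Complex Hilbert spaces\<close>

text \<open>
  A complex inner product space is a \<^class>\<open>real_inner\<close> space with a compatible complex
  structure; the real inner product is the real part of the complex one, so the norm is the
  one induced by the complex inner product.  The inner product is linear in its first argument.
\<close>

class complex_inner = real_inner +
  fixes scaleC :: "complex \<Rightarrow> 'a \<Rightarrow> 'a" (infixr "*\<^sub>C" 75)
    and cinner :: "'a \<Rightarrow> 'a \<Rightarrow> complex"
  assumes scaleR_scaleC: "r *\<^sub>R x = complex_of_real r *\<^sub>C x"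
    and scaleC_add_right: "a *\<^sub>C (x + y) = a *\<^sub>C x + a *\<^sub>C y"
    and scaleC_add_left: "(a + b) *\<^sub>C x = a *\<^sub>C x + b *\<^sub>C x"
    and scaleC_scaleC: "a *\<^sub>C b *\<^sub>C x = (a * b) *\<^sub>C x"
    and scaleC_one: "1 *\<^sub>C x = x"
    and cinner_commute: "cinner x y = cnj (cinner y x)"
    and cinner_add_left: "cinner (x + y) z = cinner x z + cinner y z"
    and cinner_scaleC_left: "cinner (a *\<^sub>C x) y = a * cinner x y"
    and inner_eq_Re_cinner: "inner x y = Re (cinner x y)"

class chilbert_space = complex_inner + complete_space

text \<open>The Hilbert space direct sum; the library's norm on pairs is already the Hilbert sum norm.\<close>

instantiation prod :: (complex_inner, complex_inner) complex_inner
begin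

definition scaleC_prod_def: "a *\<^sub>C x = (a *\<^sub>C fst x, a *\<^sub>C snd x)"

definition cinner_prod_def: "cinner x y = cinner (fst x) (fst y) + cinner (snd x) (snd y)"

instance
proof
  fix x y z :: "'a \<times> 'b" and a b :: complex and r :: real
  show "r *\<^sub>R x = complex_of_real r *\<^sub>C x"
    by (simp add: scaleC_prod_def scaleR_prod_def scaleR_scaleC)
  show "a *\<^sub>C (x + y) = a *\<^sub>C x + a *\<^sub>C y"
    by (simp add: scaleC_prod_def scaleC_add_right)
  show "(a + b) *\<^sub>C x = a *\<^sub>C x + b *\<^sub>C x"
    by (simp add: scaleC_prod_def scaleC_add_left)
  show "a *\<^sub>C b *\<^sub>C x = (a * b) *\<^sub>C x"
    by (simp add: scaleC_prod_def scaleC_scaleC)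
  show "1 *\<^sub>C x = x"
    by (simp add: scaleC_prod_def scaleC_one)
  show "cinner x y = cnj (cinner y x)"
    unfolding cinner_prod_def complex_cnj_add
    using cinner_commute[of "fst x" "fst y"] cinner_commute[of "snd x" "snd y"] by argo
  show "cinner (x + y) z = cinner x z + cinner y z"
    by (simp add: cinner_prod_def cinner_add_left)
  show "cinner (a *\<^sub>C x) y = a * cinner x y"
    by (simp add: cinner_prod_def scaleC_prod_def cinner_scaleC_left distrib_left)
  show "inner x y = Re (cinner x y)"
    by (simp add: cinner_prod_def inner_prod_def inner_eq_Re_cinner)
qed

end

instance prod :: (chilbert_space, chilbert_space) chilbert_space ..

instantiation complex :: chilbert_space
begin

definition scaleC_complex_def: "a *\<^sub>C (x::complex) = a * x"

definition cinner_complex_def: "cinner (x::complex) y = x * cnj y"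

instance
proof
  fix x y z a b :: complex and r :: real
  show "r *\<^sub>R x = complex_of_real r *\<^sub>C x"
    unfolding scaleC_complex_def by (rule scaleR_conv_of_real)
  show "a *\<^sub>C (x + y) = a *\<^sub>C x + a *\<^sub>C y"
    unfolding scaleC_complex_def by (rule distrib_left)
  show "(a + b) *\<^sub>C x = a *\<^sub>C x + b *\<^sub>C x"
    unfolding scaleC_complex_def by (rule distrib_right)
  show "a *\<^sub>C b *\<^sub>C x = (a * b) *\<^sub>C x"
    unfolding scaleC_complex_def by (rule mult.assoc[symmetric])
  show "1 *\<^sub>C x = x"
    unfolding scaleC_complex_def by (rule mult_1)
  show "cinner x y = cnj (cinner y x)"
    unfolding cinner_complex_def by simp
  show "cinner (x + y) z = cinner x z + cinner y z"
    unfolding cinner_complex_def by (rule distrib_right)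
  show "cinner (a *\<^sub>C x) y = a * cinner x y"
    unfolding cinner_complex_def scaleC_complex_def by (rule mult.assoc)
  show "inner x y = Re (cinner x y)"
    unfolding cinner_complex_def by (simp add: inner_complex_def)
qed

end


section \<open>Bounded complex-linear operators\<close>

text \<open>
  \<open>BH\<close> is the algebra of bounded complex-linear operators, as a subset of the type of bounded
  real-linear maps; addition, norm (the operator norm), norm topology and composition are those
  of that type.
\<close>

definition BH :: "('a::complex_inner \<Rightarrow>\<^sub>L 'a) set" where
  "BH = {A. \<forall>c x. blinfun_apply A (c *\<^sub>C x) = c *\<^sub>C blinfun_apply A x}"

definition cadjoint :: "('a::complex_inner \<Rightarrow>\<^sub>L 'a) \<Rightarrow> ('a \<Rightarrow>\<^sub>L 'a)" where
  "cadjoint A = (THE B. \<forall>x y. cinner (blinfun_apply A x) y = cinner x (blinfun_apply B y))"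

definition positive_op :: "('a::complex_inner \<Rightarrow>\<^sub>L 'a) \<Rightarrow> bool" where
  "positive_op A \<longleftrightarrow> A \<in> BH \<and>
     (\<forall>x. cinner (blinfun_apply A x) x \<in> \<real> \<and> Re (cinner (blinfun_apply A x) x) \<ge> 0)"

definition unitary_op :: "('a::complex_inner \<Rightarrow>\<^sub>L 'a) \<Rightarrow> bool" where
  "unitary_op U \<longleftrightarrow> U \<in> BH \<and>
     cadjoint U o\<^sub>L U = id_blinfun \<and> U o\<^sub>L cadjoint U = id_blinfun"

text \<open>The element \<open>0\<close> only matters for the zero space, which has no unit vectors.\<close>

definition num_radius :: "('a::complex_inner \<Rightarrow>\<^sub>L 'a) \<Rightarrow> real" where
  "num_radius A = Sup (insert 0 {cmod (cinner (blinfun_apply A z) z) | z. norm z = 1})"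


section \<open>Powers of positive operators\<close>

definition spectrum :: "('a::complex_inner \<Rightarrow>\<^sub>L 'a) \<Rightarrow> complex set" where
  "spectrum A = {l. \<not> (\<exists>B\<in>BH. \<forall>x.
     blinfun_apply B (blinfun_apply A x - l *\<^sub>C x) = x \<and>
     blinfun_apply A (blinfun_apply B x) - l *\<^sub>C blinfun_apply B x = x)}"

definition poly_op :: "real poly \<Rightarrow> ('a::real_normed_vector \<Rightarrow>\<^sub>L 'a) \<Rightarrow> ('a \<Rightarrow>\<^sub>L 'a)" where
  "poly_op p A = (\<Sum>i\<le>degree p. coeff p i *\<^sub>R (((o\<^sub>L) A ^^ i) id_blinfun))"

text \<open>
  Continuous functional calculus of a self-adjoint operator \<open>A\<close>: \<open>f(A)\<close> is the norm limit
  of \<open>p\<^sub>n(A)\<close> for polynomials \<open>p\<^sub>n\<close> converging to \<open>f\<close> uniformly on the (real) spectrum.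
\<close>

definition cfc :: "(real \<Rightarrow> real) \<Rightarrow> ('a::complex_inner \<Rightarrow>\<^sub>L 'a) \<Rightarrow> ('a \<Rightarrow>\<^sub>L 'a)" where
  "cfc f A = (THE B. \<forall>p :: nat \<Rightarrow> real poly.
     uniform_limit {t. complex_of_real t \<in> spectrum A} (\<lambda>n. poly (p n)) f sequentially
     \<longrightarrow> (\<lambda>n. poly_op (p n) A) \<longlonglongrightarrow> B)"

text \<open>Unlike \<open>(powr)\<close>, the power below has \<open>0\<^sup>0 = 1\<close>, and so \<open>op_rpow Z 0\<close> is the identity.\<close>

definition rpow :: "real \<Rightarrow> real \<Rightarrow> real" where
  "rpow t s = (if s = 0 then 1 else t powr s)"

definition op_rpow :: "('a::complex_inner \<Rightarrow>\<^sub>L 'a) \<Rightarrow> real \<Rightarrow> ('a \<Rightarrow>\<^sub>L 'a)" where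
  "op_rpow Z s = cfc (\<lambda>t. rpow t s) Z"


section \<open>The function \<open>\<Delta>\<close>\<close>

lift_definition block_op ::
  "('a::complex_inner \<Rightarrow>\<^sub>L 'a) \<Rightarrow> ('a \<Rightarrow>\<^sub>L 'a) \<Rightarrow> ('a \<Rightarrow>\<^sub>L 'a) \<Rightarrow> ('a \<Rightarrow>\<^sub>L 'a) \<Rightarrow> ('a \<times> 'a) \<Rightarrow>\<^sub>L ('a \<times> 'a)"
  is "\<lambda>A B C D z. (A (fst z) + B (snd z), C (fst z) + D (snd z))"
  by (rule bounded_linear_Pair; rule bounded_linear_add)
    (erule bounded_linear_compose[OF _ bounded_linear_fst]
      bounded_linear_compose[OF _ bounded_linear_snd])+

definition Delta :: "real \<Rightarrow> real \<Rightarrow> ('a::complex_inner \<Rightarrow>\<^sub>L 'a) \<Rightarrow> real" where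
  "Delta \<rho> \<nu> X =
     (let \<alpha> = sqrt (8 / \<rho> - 4); \<beta> = 2 / \<rho> - 2 in
      num_radius (block_op
        0 (\<alpha> *\<^sub>R X)
        ((\<alpha> * (1 - 2 * \<nu>)) *\<^sub>R cadjoint X) (\<beta> *\<^sub>R (X + (1 - 2 * \<nu>) *\<^sub>R cadjoint X))))"

text \<open>
  \<open>\<Delta>\<close> is not definite for \<open>\<rho> = 2\<close> and \<open>\<nu> \<in> {0, 1}\<close>: then \<open>\<alpha> = 0\<close>, \<open>\<beta> = -1\<close>, and \<open>\<Delta>\<close> is the
  numerical radius of \<open>X + X\<^sup>*\<close> or \<open>X - X\<^sup>*\<close>, which vanishes for skew-adjoint, respectively
  self-adjoint \<open>X\<close>.  On \<open>\<complex>\<close>, multiplication by the imaginary unit and the identity are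
  counterexamples.
\<close>

lemma Delta_degenerate:
  assumes "X + (1 - 2 * \<nu>) *\<^sub>R cadjoint X = 0"
  shows "Delta 2 \<nu> X = 0"
proof -
  have block: "block_op 0 0 0 0 = (0 :: ('a \<times> 'a) \<Rightarrow>\<^sub>L ('a \<times> 'a))"
    by (rule blinfun_eqI) (simp add: block_op.rep_eq zero_prod_def)
  have cinner0: "cinner 0 z = 0" for z :: "'a \<times> 'a"
    using cinner_add_left[of 0 0 z] by simp
  have "num_radius (0 :: ('a \<times> 'a) \<Rightarrow>\<^sub>L ('a \<times> 'a)) = Sup {0}"
    unfolding num_radius_def by (rule arg_cong[where f = Sup]) (auto simp: cinner0)
  then show ?thesis
    using assms by (simp add: Delta_def block)
qed

lemma cadjoint_complex_mult:
  "cadjoint (blinfun_mult_right (c::complex)) = blinfun_mult_right (cnj c)"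
  unfolding cadjoint_def
proof (rule the_equality)
  show "\<forall>x y. cinner (blinfun_apply (blinfun_mult_right c) x) y =
      cinner x (blinfun_apply (blinfun_mult_right (cnj c)) y)"
    by (simp add: cinner_complex_def)
next
  fix B :: "complex \<Rightarrow>\<^sub>L complex"
  assume B: "\<forall>x y. cinner (blinfun_apply (blinfun_mult_right c) x) y = cinner x (blinfun_apply B y)"
  show "B = blinfun_mult_right (cnj c)"
  proof (rule blinfun_eqI)
    fix y
    have "c * cnj y = cnj (blinfun_apply B y)"
      using B[rule_format, of 1 y] by (simp add: cinner_complex_def)
    then show "blinfun_apply B y = blinfun_apply (blinfun_mult_right (cnj c)) y"
      by (metis blinfun_mult_right.rep_eq complex_cnj_cnj complex_cnj_mult)
  qed
qed

lemma Delta_not_definite: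
  "\<exists>X \<in> (BH :: (complex \<Rightarrow>\<^sub>L complex) set). X \<noteq> 0 \<and> Delta 2 0 X = 0"
  "\<exists>X \<in> (BH :: (complex \<Rightarrow>\<^sub>L complex) set). X \<noteq> 0 \<and> Delta 2 1 X = 0"
proof -
  have BH: "blinfun_mult_right c \<in> BH" for c :: complex
    by (simp add: BH_def scaleC_complex_def)
  have nz: "blinfun_mult_right c \<noteq> 0" if "c \<noteq> 0" for c :: complex
  proof
    assume "blinfun_mult_right c = 0"
    then have "blinfun_apply (blinfun_mult_right c) 1 = blinfun_apply 0 1" by simp
    with that show False by simp
  qed
  have "Delta 2 0 (blinfun_mult_right \<i>) = 0"
    by (rule Delta_degenerate, rule blinfun_eqI)
      (simp add: cadjoint_complex_mult blinfun.add_left)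
  then show "\<exists>X \<in> (BH :: (complex \<Rightarrow>\<^sub>L complex) set). X \<noteq> 0 \<and> Delta 2 0 X = 0"
    using BH nz by (intro bexI[of _ "blinfun_mult_right \<i>"]) auto
  have "Delta 2 1 (blinfun_mult_right (1::complex)) = 0"
    by (rule Delta_degenerate, rule blinfun_eqI) (simp add: cadjoint_complex_mult)
  then show "\<exists>X \<in> (BH :: (complex \<Rightarrow>\<^sub>L complex) set). X \<noteq> 0 \<and> Delta 2 1 X = 0"
    using BH nz by (intro bexI[of _ "blinfun_mult_right 1"]) auto
qed

end

theory Submission
  imports Defs "HOL-Computational_Algebra.Fundamental_Theorem_Algebra"
begin

text \<open>
  \<open>\<Delta>\<close> is the numerical radius of an operator \<open>T(X)\<close> depending real-linearly on \<open>X\<close>, and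
  \<open>T(Y\<^sup>*XY) = (Y \<oplus> Y)\<^sup>* T(X) (Y \<oplus> Y)\<close>; this gives all parts but (vi) almost directly.

  For (vi), \<open>w(T) = sup\<^sub>\<theta> \<parallel>Re(e\<^sup>i\<^sup>\<theta> T)\<parallel>\<close>, and taking real parts commutes with \<open>T \<mapsto> P T P\<close> for
  self-adjoint \<open>P\<close>.  So it suffices to show \<open>\<parallel>P\<^sup>s H P\<^sup>s\<parallel> \<le> \<parallel>P H P\<parallel>\<^sup>s \<parallel>H\<parallel>\<^sup>1\<^sup>-\<^sup>s\<close> for self-adjoint \<open>H\<close>.
  With \<open>c = (a + b) / 2\<close>, the operators \<open>(P\<^sup>c H P\<^sup>c)\<^sup>2\<close> and \<open>(P\<^sup>a H P\<^sup>a)(P\<^sup>b H P\<^sup>b)\<close> arise from each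
  other by cyclic permutation of the factors, so the norm of the latter dominates the spectral
  radius of the former.  Hence \<open>s \<mapsto> \<parallel>P\<^sup>s H P\<^sup>s\<parallel>\<close> is midpoint log-convex, and since it is bounded it
  is log-convex.
\<close>

section \<open>Complex inner products\<close>

instance chilbert_space \<subseteq> banach ..

lemma cinner_add_right: "cinner x (y + z) = cinner x y + cinner x z"
  by (metis cinner_add_left cinner_commute complex_cnj_add)

lemma cinner_scaleC_right: "cinner x (a *\<^sub>C y) = cnj a * cinner x y"
  by (metis cinner_scaleC_left cinner_commute complex_cnj_mult)

lemma cinner_scaleR_left: "cinner (r *\<^sub>R x) y = of_real r * cinner x y"
  by (simp add: scaleR_scaleC cinner_scaleC_left)

lemma cinner_scaleR_right: "cinner x (r *\<^sub>R y) = of_real r * cinner x y"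
  by (simp add: scaleR_scaleC cinner_scaleC_right)

lemma cinner_zero_left [simp]: "cinner 0 y = 0"
  using cinner_add_left[of 0 0 y] by simp

lemma cinner_zero_right [simp]: "cinner y 0 = 0"
  using cinner_add_right[of y 0 0] by simp

lemma cinner_minus_left: "cinner (- x) y = - cinner x y"
  using cinner_scaleR_left[of "-1" x y] by simp

lemma cinner_diff_left: "cinner (x - z) y = cinner x y - cinner z y"
  using cinner_add_left[of x "- z" y] by (simp add: cinner_minus_left)

text \<open>Since \<open>Im c = - Re (\<i> * c)\<close>, the complex form is recovered from the real
  one. This is how real adjoints become complex ones.\<close>

lemma cinner_eq_Complex: "cinner x y = Complex (inner x y) (- inner (\<i> *\<^sub>C x) y)"
  by (simp add: complex_eq_iff inner_eq_Re_cinner cinner_scaleC_left)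

lemma cinner_same: "cinner x x = of_real ((norm x)\<^sup>2)"
proof -
  have "Im (cinner x x) = 0"
    using cinner_commute[of x x] by (metis complex_In_mult_cnj_zero complex_cnj_cancel_iff cnj.sel(2) neg_equal_zero)
  moreover have "Re (cinner x x) = (norm x)\<^sup>2"
    by (simp add: power2_norm_eq_inner inner_eq_Re_cinner)
  ultimately show ?thesis
    by (simp add: complex_eq_iff)
qed

lemma norm_scaleC: "norm (a *\<^sub>C x) = cmod a * norm (x :: 'a::complex_inner)"
proof -
  have "complex_of_real ((norm (a *\<^sub>C x))\<^sup>2) = a * cnj a * of_real ((norm x)\<^sup>2)"
    unfolding cinner_same[symmetric] by (simp only: cinner_scaleC_left cinner_scaleC_right mult_ac)
  also have "\<dots> = of_real ((cmod a * norm x)\<^sup>2)"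
    by (simp add: complex_norm_square[symmetric] power_mult_distrib)
  finally have "(norm (a *\<^sub>C x))\<^sup>2 = (cmod a * norm x)\<^sup>2"
    unfolding of_real_eq_iff .
  then show ?thesis
    by simp
qed

text \<open>Rotating a value onto the nonnegative real axis turns bounds on a modulus into bounds on
  a real part, which is all that \<open>inner\<close> sees.\<close>

lemma ex_unit_rotation: "\<exists>\<omega>. cmod \<omega> = 1 \<and> \<omega> * c = of_real (cmod c)"
proof (cases "c = 0")
  case True
  then show ?thesis by (intro exI[of _ 1]) simp
next
  case False
  then show ?thesis
    by (intro exI[of _ "cnj c / cmod c"])
      (simp add: norm_divide mult.commute[of "cnj c"] complex_norm_square[symmetric] power2_eq_square)
qed

lemma cmod_cinner_le: "cmod (cinner x y) \<le> norm x * norm y"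
proof -
  obtain \<omega> where \<omega>: "cmod \<omega> = 1" "\<omega> * cinner x y = of_real (cmod (cinner x y))"
    using ex_unit_rotation by blast
  then have "cmod (cinner x y) = inner (\<omega> *\<^sub>C x) y"
    by (simp add: inner_eq_Re_cinner cinner_scaleC_left)
  also have "\<dots> \<le> norm (\<omega> *\<^sub>C x) * norm y"
    by (rule norm_cauchy_schwarz)
  finally show ?thesis
    using \<omega> by (simp add: norm_scaleC)
qed

lemma cinner_left_ext: "(\<And>z. cinner x z = cinner y z) \<Longrightarrow> x = y"
  by (metis cinner_diff_left cinner_same diff_eq_diff_eq eq_iff_diff_eq_0 norm_eq_zero
      of_real_eq_0_iff power_eq_0_iff)

lemma cinner_right_ext: "(\<And>z. cinner z x = cinner z y) \<Longrightarrow> x = y"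
  by (metis cinner_commute cinner_left_ext)

lemma bounded_linear_cinner_left: "bounded_linear (\<lambda>x. cinner x y)"
  by (rule bounded_linear_intro[of _ "norm y"])
    (simp_all add: cinner_add_left cinner_scaleR_left cmod_cinner_le scaleR_conv_of_real)

lemma bounded_linear_scaleC: "bounded_linear (\<lambda>x::'a::complex_inner. a *\<^sub>C x)"
  by (rule bounded_linear_intro[of _ "cmod a"])
    (simp_all add: scaleC_add_right scaleR_scaleC scaleC_scaleC norm_scaleC mult.commute)

section \<open>Adjoints\<close>

text \<open>The representing vector minimises \<open>\<parallel>x\<parallel>\<^sup>2 - 2 f(x)\<close>; minimising sequences are Cauchy by the
  parallelogram law.\<close>

lemma riesz_representation:
  fixes f :: "'a::{real_inner, complete_space} \<Rightarrow> real"
  assumes f: "bounded_linear f"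
  shows "\<exists>y. \<forall>x. f x = inner x y"
proof -
  interpret f: bounded_linear f by (rule f)
  define J where "J x = inner x x - 2 * f x" for x
  obtain K where K: "\<And>x. norm (f x) \<le> norm x * K"
    using f.bounded by blast
  have "- K\<^sup>2 \<le> J x" for x
  proof -
    have "f x \<le> norm x * K"
      using K[of x] by simp
    moreover have "0 \<le> (norm x - K)\<^sup>2"
      by simp
    ultimately show ?thesis
      by (simp add: J_def power2_norm_eq_inner[symmetric] power2_diff)
  qed
  then have bdd: "bdd_below (range J)"
    by (intro bdd_belowI[of _ "- K\<^sup>2"]) auto
  define m where "m = Inf (range J)"
  have m: "m \<le> J x" for x
    unfolding m_def by (rule cInf_lower[OF _ bdd]) simp
  have "\<exists>u. J u < m + inverse (Suc n)" for n
    using cInf_lessD[of "range J" "m + inverse (Suc n)"] unfolding m_def by fastforce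
  then obtain u where u: "\<And>n. J (u n) < m + inverse (Suc n)"
    by metis
  have par: "inner (x - y) (x - y) \<le> 2 * (J x - m) + 2 * (J y - m)" for x y
  proof -
    have "inner (x - y) (x - y) = 2 * J x + 2 * J y - 4 * J ((1/2) *\<^sub>R (x + y))"
      by (simp add: J_def f.add f.scaleR inner_commute algebra_simps)
    then show ?thesis
      using m[of "(1/2) *\<^sub>R (x + y)"] by simp
  qed
  have "Cauchy u"
  proof (rule metric_CauchyI)
    fix e :: real
    assume "0 < e"
    then obtain N where N: "inverse (real (Suc N)) < e\<^sup>2 / 4"
      using reals_Archimedean[of "e\<^sup>2 / 4"] by auto
    have "dist (u i) (u j) < e" if "N \<le> i" "N \<le> j" for i j
    proof -
      have J: "J (u k) - m < e\<^sup>2 / 4" if "N \<le> k" for k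
      proof -
        have "inverse (real (Suc k)) \<le> inverse (real (Suc N))"
          using that by (simp add: le_imp_inverse_le)
        then have "J (u k) < m + e\<^sup>2 / 4"
          by (meson N u add_strict_left_mono order_le_less_trans order_less_trans)
        then show ?thesis
          by simp
      qed
      have "2 * (J (u i) - m) + 2 * (J (u j) - m) < e\<^sup>2"
        using J[OF \<open>N \<le> i\<close>] J[OF \<open>N \<le> j\<close>] by argo
      then have "(dist (u i) (u j))\<^sup>2 < e\<^sup>2"
        unfolding dist_norm power2_norm_eq_inner by (rule order_le_less_trans[OF par])
      then show ?thesis
        using \<open>0 < e\<close> by (simp add: power_less_imp_less_base)
    qed
    then show "\<exists>N. \<forall>i\<ge>N. \<forall>j\<ge>N. dist (u i) (u j) < e"
      by blast
  qed
  then obtain y where y: "u \<longlonglongrightarrow> y"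
    using Cauchy_convergent_iff convergent_def by blast
  have "(\<lambda>n. J (u n)) \<longlonglongrightarrow> J y"
    unfolding J_def by (intro tendsto_intros f.tendsto y)
  moreover have "(\<lambda>n. m + inverse (real (Suc n))) \<longlonglongrightarrow> m"
    using LIMSEQ_inverse_real_of_nat_add[of m] by simp
  ultimately have Jy: "J y \<le> m"
    by (rule LIMSEQ_le) (use u less_imp_le in blast)
  have "f x = inner x y" for x
  proof -
    define a b where "a = inner x x" and "b = inner x y - f x"
    have "0 \<le> t\<^sup>2 * a + 2 * t * b" for t
    proof -
      have "J (y + t *\<^sub>R x) = J y + (t\<^sup>2 * a + 2 * t * b)"
        by (simp add: J_def a_def b_def f.add f.scaleR inner_commute algebra_simps power2_eq_square)
      then show ?thesis
        using Jy m[of "y + t *\<^sub>R x"] by linarith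
    qed
    \<comment> \<open>The quadratic is smallest at \<open>- b / a\<close>; the shift to
      \<open>a + 1\<close> also covers \<open>x = 0\<close> and still forces
      \<open>b = 0\<close>.\<close>
    from this[of "- b / (a + 1)"] have "0 \<le> (b\<^sup>2 * a / (a + 1)\<^sup>2) - 2 * b\<^sup>2 / (a + 1)"
      by (simp add: power_divide power2_eq_square)
    moreover have a: "0 \<le> a"
      by (simp add: a_def)
    ultimately have "0 \<le> ((b\<^sup>2 * a / (a + 1)\<^sup>2) - 2 * b\<^sup>2 / (a + 1)) * (a + 1)\<^sup>2"
      by (intro mult_nonneg_nonneg) auto
    also have "\<dots> = b\<^sup>2 * a - 2 * b\<^sup>2 * (a + 1)"
      using a by (simp add: left_diff_distrib power2_eq_square)
    finally have "b\<^sup>2 * (a + 2) \<le> 0"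
      by (simp add: algebra_simps)
    then have "b = 0"
      using a by (simp add: mult_le_0_iff)
    then show ?thesis
      by (simp add: b_def)
  qed
  then show ?thesis
    by blast
qed

text \<open>Riesz representation for each functional \<open>\<lambda>x. inner (A x) y\<close>; the
  resulting map is bounded because \<open>norm (b x) * norm (b x) = inner (A (b x)) x\<close>.
  Working with the real structure makes it available for symmetrising real-linear maps as
  well.\<close>

lemma ex_real_adjoint:
  fixes A :: "'a::{real_inner, complete_space} \<Rightarrow>\<^sub>L 'a"
  shows "\<exists>B :: 'a \<Rightarrow>\<^sub>L 'a. \<forall>x y. inner (A x) y = inner x (B y)"
proof -
  have "\<exists>z. \<forall>x. inner (A x) y = inner x z" for y
    by (rule riesz_representation)
      (intro bounded_linear_compose[OF bounded_linear_inner_left blinfun.bounded_linear_right])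
  then obtain b where b: "\<And>x y. inner (A x) y = inner x (b y)"
    by metis
  have eqI: "v = w" if "\<And>x. inner x v = inner x w" for v w :: 'a
    using that[of "v - w"] inner_eq_zero_iff[of "v - w"] by (simp add: inner_diff_right)
  have "bounded_linear b"
  proof (rule bounded_linear_intro)
    show "b (x + y) = b x + b y" for x y
      by (rule eqI) (simp add: b[symmetric] inner_add_right)
    show "b (r *\<^sub>R x) = r *\<^sub>R b x" for r x
      by (rule eqI) (simp add: b[symmetric])
    show "norm (b x) \<le> norm x * norm A" for x
    proof -
      have "norm (b x) * norm (b x) = inner (A (b x)) x"
        by (simp add: b power2_norm_eq_inner[symmetric] power2_eq_square)
      also have "\<dots> \<le> norm (A (b x)) * norm x"
        by (rule norm_cauchy_schwarz)
      also have "\<dots> \<le> norm A * norm (b x) * norm x"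
        by (intro mult_right_mono norm_blinfun) simp
      finally have "norm (b x) * norm (b x) \<le> norm (b x) * (norm x * norm A)"
        by (simp add: mult_ac)
      then show ?thesis
        by (cases "b x = 0") auto
    qed
  qed
  then show ?thesis
    using b by (intro exI[of _ "Blinfun b"]) (simp add: bounded_linear_Blinfun_apply)
qed

lemma BH_iff: "A \<in> BH \<longleftrightarrow> (\<forall>c x. blinfun_apply A (c *\<^sub>C x) = c *\<^sub>C blinfun_apply A x)"
  by (simp add: BH_def)

lemma BH_scaleC: "A \<in> BH \<Longrightarrow> blinfun_apply A (c *\<^sub>C x) = c *\<^sub>C blinfun_apply A x"
  by (simp add: BH_def)

lemma cadjoint_eqI:
  assumes "\<And>x y. cinner (blinfun_apply A x) y = cinner x (blinfun_apply B y)"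
  shows "cadjoint A = B"
  unfolding cadjoint_def
proof (rule the_equality)
  show "C = B" if "\<forall>x y. cinner (blinfun_apply A x) y = cinner x (blinfun_apply C y)" for C
    by (rule blinfun_eqI, rule cinner_right_ext) (use that assms in simp)
qed (use assms in blast)

lemma cinner_cadjoint:
  fixes A :: "'a::chilbert_space \<Rightarrow>\<^sub>L 'a"
  assumes A: "A \<in> BH"
  shows "cinner (A x) y = cinner x (cadjoint A y)"
proof -
  obtain B :: "'a \<Rightarrow>\<^sub>L 'a" where B: "\<And>x y. inner (A x) y = inner x (B y)"
    using ex_real_adjoint by blast
  \<comment> \<open>As \<open>A\<close> commutes with multiplication by \<open>\<i>\<close>, the
    real adjoint identity at \<open>x\<close> and at \<open>\<i> *\<^sub>C x\<close> matches both
    the real and the imaginary parts.\<close>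
  have *: "cinner (A x) y = cinner x (B y)" for x y
    unfolding cinner_eq_Complex BH_scaleC[OF A, symmetric] B ..
  then have "cadjoint A = B"
    by (rule cadjoint_eqI)
  with * show ?thesis
    by simp
qed

lemma cinner_cadjoint_left:
  fixes A :: "'a::chilbert_space \<Rightarrow>\<^sub>L 'a"
  assumes "A \<in> BH"
  shows "cinner (cadjoint A x) y = cinner x (A y)"
  by (metis assms cinner_cadjoint cinner_commute)

text \<open>Scalars can be pulled out of the first argument of \<open>cinner x (B y)\<close>, and
  nondegeneracy then moves them through \<open>A\<close>; \<open>B\<close> may be an arbitrary
  function.\<close>

lemma BH_if_cinner_adjoint:
  assumes "\<And>x y. cinner (blinfun_apply A x) y = cinner x (B y)"
  shows "A \<in> BH"
  unfolding BH_iff by (intro allI, rule cinner_left_ext) (simp add: assms cinner_scaleC_left)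

lemma BH_cadjoint:
  fixes A :: "'a::chilbert_space \<Rightarrow>\<^sub>L 'a"
  assumes "A \<in> BH"
  shows "cadjoint A \<in> BH"
  by (rule BH_if_cinner_adjoint) (rule cinner_cadjoint_left[OF assms])

lemma cadjoint_cadjoint:
  fixes A :: "'a::chilbert_space \<Rightarrow>\<^sub>L 'a"
  assumes "A \<in> BH"
  shows "cadjoint (cadjoint A) = A"
  by (rule cadjoint_eqI) (rule cinner_cadjoint_left[OF assms])

lemma BH_add: "A \<in> BH \<Longrightarrow> B \<in> BH \<Longrightarrow> A + B \<in> BH"
  by (simp add: BH_iff blinfun.add_left scaleC_add_right)

lemma BH_scaleR: "A \<in> BH \<Longrightarrow> r *\<^sub>R A \<in> BH"
  by (simp add: BH_iff blinfun.scaleR_left scaleR_scaleC scaleC_scaleC mult.commute)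

lemma BH_compose: "A \<in> BH \<Longrightarrow> B \<in> BH \<Longrightarrow> A o\<^sub>L B \<in> BH"
  by (simp add: BH_iff)

text \<open>Polarisation: the form at \<open>x + y\<close> shows that \<open>cinner (A x) y\<close>
  and \<open>cinner (A y) x\<close> have sum 0, the form at \<open>x + \<i> *\<^sub>C y\<close> that
  they are equal.\<close>

lemma BH_eq_zero_if_form_zero:
  assumes A: "A \<in> BH" and form: "\<And>x. cinner (blinfun_apply A x) x = 0"
  shows "A = 0"
proof (rule blinfun_eqI, rule cinner_left_ext)
  fix x y
  have "cinner (A x) y + cinner (A y) x = 0"
    using form[of "x + y"] by (simp add: blinfun.add_right cinner_add_left cinner_add_right form add.commute)
  moreover have "- (\<i> * cinner (A x) y) + \<i> * cinner (A y) x = 0"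
    using form[of "x + \<i> *\<^sub>C y"]
    by (simp add: blinfun.add_right cinner_add_left cinner_add_right form BH_scaleC[OF A]
        cinner_scaleC_left cinner_scaleC_right)
  ultimately show "cinner (A x) y = cinner (blinfun_apply 0 x) y"
    by (simp add: complex_eq_iff)
qed

section \<open>The numerical radius\<close>

lemma cmod_form_le_norm:
  assumes "norm z = 1"
  shows "cmod (cinner (blinfun_apply A z) z) \<le> norm A"
  using cmod_cinner_le[of "A z" z] norm_blinfun[of A z] assms by simp

lemma num_radius_bdd: "bdd_above (insert 0 {cmod (cinner (blinfun_apply A z) z) | z. norm z = 1})"
  by (rule bdd_aboveI[of _ "norm A"]) (auto simp: cmod_form_le_norm)

lemma num_radius_nonneg: "0 \<le> num_radius A"
  unfolding num_radius_def by (rule cSup_upper[OF _ num_radius_bdd]) simp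

lemma cmod_form_le_num_radius: "cmod (cinner (blinfun_apply A z) z) \<le> num_radius A * (norm z)\<^sup>2"
proof (cases "z = 0")
  case False
  define u where "u = z /\<^sub>R norm z"
  have u: "norm u = 1" and z: "z = norm z *\<^sub>R u"
    using False by (simp_all add: u_def)
  have "cmod (cinner (A u) u) \<le> num_radius A"
    unfolding num_radius_def by (rule cSup_upper[OF _ num_radius_bdd]) (use u in auto)
  moreover have "cinner (A z) z = of_real ((norm z)\<^sup>2) * cinner (A u) u"
    by (subst (1 2) z)
      (simp add: blinfun.scaleR_right cinner_scaleR_left cinner_scaleR_right power2_eq_square)
  ultimately show ?thesis
    by (simp add: norm_mult norm_power mult.commute[of "num_radius A"] mult_left_mono)
qed (simp add: blinfun.zero_right)

lemma num_radius_leI: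
  assumes "0 \<le> c" and "\<And>z. norm z = 1 \<Longrightarrow> cmod (cinner (blinfun_apply A z) z) \<le> c"
  shows "num_radius A \<le> c"
  unfolding num_radius_def by (rule cSup_least) (use assms in auto)

lemma num_radius_add_le: "num_radius (A + B) \<le> num_radius A + num_radius B"
proof (rule num_radius_leI)
  fix z :: 'a
  assume "norm z = 1"
  then show "cmod (cinner ((A + B) z) z) \<le> num_radius A + num_radius B"
    using norm_triangle_ineq[of "cinner (A z) z" "cinner (B z) z"]
      cmod_form_le_num_radius[of A z] cmod_form_le_num_radius[of B z]
    by (simp add: blinfun.add_left cinner_add_left)
qed (simp add: num_radius_nonneg)

lemma num_radius_le_norm: "num_radius A \<le> norm A"
  by (rule num_radius_leI) (simp_all add: cmod_form_le_norm)

lemma num_radius_scaleR: "num_radius (r *\<^sub>R A) = \<bar>r\<bar> * num_radius A"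
proof (rule antisym)
  have le: "num_radius (r *\<^sub>R A) \<le> \<bar>r\<bar> * num_radius A" for r and A :: "'a \<Rightarrow>\<^sub>L 'a"
  proof (rule num_radius_leI)
    fix z :: 'a
    assume "norm z = 1"
    then show "cmod (cinner ((r *\<^sub>R A) z) z) \<le> \<bar>r\<bar> * num_radius A"
      using cmod_form_le_num_radius[of A z]
      by (simp add: blinfun.scaleR_left cinner_scaleR_left norm_mult mult_left_mono)
  qed (simp add: num_radius_nonneg)
  show "num_radius (r *\<^sub>R A) \<le> \<bar>r\<bar> * num_radius A"
    by (rule le)
  show "\<bar>r\<bar> * num_radius A \<le> num_radius (r *\<^sub>R A)"
  proof (cases "r = 0")
    case False
    then have "num_radius A \<le> \<bar>inverse r\<bar> * num_radius (r *\<^sub>R A)"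
      using le[of "inverse r" "r *\<^sub>R A"] by simp
    with False show ?thesis
      by (simp add: field_simps)
  qed (simp add: num_radius_nonneg)
qed

text \<open>A seminorm dominated by the operator norm is 1-Lipschitz for it, hence
  continuous.\<close>

lemma num_radius_diff_le: "\<bar>num_radius A - num_radius B\<bar> \<le> norm (A - B)"
  using num_radius_add_le[of B "A - B"] num_radius_add_le[of A "B - A"]
    num_radius_le_norm[of "A - B"] num_radius_le_norm[of "B - A"] norm_minus_commute[of A B]
  by simp

lemma tendsto_num_radius:
  assumes "(f \<longlongrightarrow> A) F"
  shows "((\<lambda>r. num_radius (f r)) \<longlongrightarrow> num_radius A) F"
proof -
  have "((\<lambda>r. num_radius (f r) - num_radius A) \<longlongrightarrow> 0) F"
    using tendsto_norm_zero[OF LIM_zero[OF assms]]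
    by (rule Lim_null_comparison[rotated]) (simp add: num_radius_diff_le)
  then show ?thesis
    by (simp add: LIM_zero_iff)
qed

section \<open>Norms of symmetric operators\<close>

text \<open>Self-adjointness for the real inner product only: the operators \<open>H\<close> in the
  interpolation argument arise as real symmetric parts.\<close>

definition symmetric_op :: "('a::real_inner \<Rightarrow>\<^sub>L 'a) \<Rightarrow> bool" where
  "symmetric_op A \<longleftrightarrow> (\<forall>x y. inner (blinfun_apply A x) y = inner x (blinfun_apply A y))"

lemma symmetric_opD: "symmetric_op A \<Longrightarrow> inner (blinfun_apply A x) y = inner x (blinfun_apply A y)"
  by (simp add: symmetric_op_def)

lemma symmetric_op_sandwich:
  "symmetric_op A \<Longrightarrow> symmetric_op H \<Longrightarrow> symmetric_op (A o\<^sub>L H o\<^sub>L A)"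
  by (simp add: symmetric_op_def)

text \<open>Polarisation with \<open>y\<close> the multiple of \<open>A x\<close> that has the
  length of \<open>x\<close>: \<open>4 * inner (A x) y\<close> is the difference of the forms at
  \<open>x + y\<close> and \<open>x - y\<close>, and the parallelogram law sums their bounds to
  \<open>4 * c * (norm x)\<^sup>2\<close>.\<close>

lemma symmetric_op_norm_leI:
  fixes A :: "'a::real_inner \<Rightarrow>\<^sub>L 'a"
  assumes A: "symmetric_op A" and c: "0 \<le> c"
    and form: "\<And>x. \<bar>inner (A x) x\<bar> \<le> c * (norm x)\<^sup>2"
  shows "norm A \<le> c"
proof (rule norm_blinfun_bound[OF c])
  fix x
  show "norm (A x) \<le> c * norm x"
  proof (cases "A x = 0")
    case False
    then have x: "x \<noteq> 0"
      by (auto simp: blinfun.zero_right)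
    define y where "y = (norm x / norm (A x)) *\<^sub>R A x"
    have y: "inner y y = (norm x)\<^sup>2"
      using False by (simp add: y_def power2_norm_eq_inner[symmetric])
    have "4 * (norm x * norm (A x)) = 4 * inner (A x) y"
      using False by (simp add: y_def power2_norm_eq_inner[symmetric] power2_eq_square)
    also have "\<dots> = inner (A (x + y)) (x + y) - inner (A (x - y)) (x - y)"
      using symmetric_opD[OF A, of x y]
      by (simp add: blinfun.add_right blinfun.diff_right inner_add_left inner_add_right
          inner_diff_left inner_diff_right inner_commute)
    also have "\<dots> \<le> c * (norm (x + y))\<^sup>2 + c * (norm (x - y))\<^sup>2"
      using form[of "x + y"] form[of "x - y"] by linarith
    also have "\<dots> = 4 * (c * (norm x)\<^sup>2)"
      using y by (simp add: power2_norm_eq_inner inner_add_left inner_add_right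
          inner_diff_left inner_diff_right inner_commute algebra_simps)
    finally have "norm x * norm (A x) \<le> norm x * (c * norm x)"
      by (simp add: power2_eq_square mult_ac)
    then show ?thesis
      using x by simp
  qed (use c in simp)
qed

text \<open>With \<open>l = (norm A)\<^sup>2\<close> and \<open>x\<close> a unit vector, expanding
  the square gives at most \<open>2 * l * (l - (norm (A x))\<^sup>2)\<close>, which is small once
  \<open>norm (A x)\<close> is close to \<open>norm A\<close>. Passing to the square of
  \<open>A\<close> avoids choosing between the spectral values \<open>norm A\<close> and
  \<open>- norm A\<close>.\<close>

lemma symmetric_op_approx_eigenvector:
  fixes A :: "'a::real_inner \<Rightarrow>\<^sub>L 'a"
  assumes A: "symmetric_op A" and nz: "A \<noteq> 0" and e: "0 < e"
  shows "\<exists>x. norm x = 1 \<and> norm (A (A x) - (norm A)\<^sup>2 *\<^sub>R x) < e"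
proof -
  define l where "l = (norm A)\<^sup>2"
  \<comment> \<open>Chosen so that \<open>2 * l * d\<close> equals half of
    \<open>e\<^sup>2\<close>.\<close>
  define d where "d = e\<^sup>2 / (4 * l)"
  have l: "0 < l" and d: "0 < d"
    using nz e by (simp_all add: l_def d_def)
  \<comment> \<open>Truncation at 0 covers the case in which \<open>d\<close> exceeds
    \<open>l\<close>.\<close>
  define c where "c = sqrt (max 0 (l - d))"
  have "c < sqrt l"
    unfolding c_def using l d by (intro real_sqrt_less_mono) auto
  then have "c < norm A"
    by (simp add: l_def)
  then have "\<not> (\<forall>x. norm (A x) \<le> c * norm x)"
    using norm_blinfun_bound[of c A] by (auto simp: c_def)
  then obtain v where v: "c * norm v < norm (A v)"
    by (auto simp: not_le)
  then have "v \<noteq> 0"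
    by (auto simp: blinfun.zero_right)
  define x where "x = v /\<^sub>R norm v"
  have x: "norm x = 1" and "c < norm (A x)"
    using v \<open>v \<noteq> 0\<close> by (simp_all add: x_def blinfun.scaleR_right field_simps)
  then have "l - (norm (A x))\<^sup>2 < d"
    using real_le_rsqrt[of "norm (A x)" "max 0 (l - d)"] unfolding c_def by linarith
  moreover have "norm (A (A x)) \<le> l"
    using norm_blinfun[of A "A x"] mult_left_mono[OF norm_blinfun[of A x], of "norm A"] x
    by (simp add: l_def power2_eq_square)
  then have "(norm (A (A x)))\<^sup>2 \<le> l\<^sup>2"
    by (simp add: power_mono)
  moreover have "(norm (A (A x) - l *\<^sub>R x))\<^sup>2 = (norm (A (A x)))\<^sup>2 - 2 * l * (norm (A x))\<^sup>2 + l\<^sup>2"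
    using x symmetric_opD[OF A, of "A x" x]
    by (simp add: power2_norm_eq_inner inner_diff_left inner_diff_right inner_commute
        power2_eq_square[of l] norm_eq_1 algebra_simps)
  ultimately have less: "l - (norm (A x))\<^sup>2 < d"
    and le: "(norm (A (A x) - l *\<^sub>R x))\<^sup>2 \<le> 2 * l * (l - (norm (A x))\<^sup>2)"
    by (simp_all add: power2_eq_square[of l] algebra_simps)
  note le
  also have "2 * l * (l - (norm (A x))\<^sup>2) < 2 * l * d"
    using l less by simp
  also have "\<dots> < e\<^sup>2"
    using l e by (simp add: d_def)
  finally have "norm (A (A x) - l *\<^sub>R x) < e"
    using e by (simp add: power_less_imp_less_base)
  with x show ?thesis
    unfolding l_def by blast
qed

text \<open>An approximate eigenvector \<open>x\<close> of \<open>A\<^sup>2\<close> is carried by \<open>V\<close> to one of \<open>L\<close>, and \<open>V x\<close> stays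
  away from \<open>0\<close> because \<open>W V x\<close> is close to \<open>\<parallel>A\<parallel>\<^sup>2 x\<close>.\<close>

lemma symmetric_op_norm_sq_le_intertwined:
  fixes A V W L :: "'a::real_inner \<Rightarrow>\<^sub>L 'a"
  assumes A: "symmetric_op A"
    and fac: "\<And>x. A (A x) = W (V x)" and inter: "\<And>x. V (A (A x)) = L (V x)"
  shows "(norm A)\<^sup>2 \<le> norm L"
proof (rule ccontr)
  assume "\<not> (norm A)\<^sup>2 \<le> norm L"
  define l where "l = (norm A)\<^sup>2"
  define g where "g = l - norm L"
  have g: "0 < g" and l: "0 < l"
    using \<open>\<not> _\<close> norm_ge_zero[of L] unfolding g_def l_def by linarith+
  \<comment> \<open>\<open>k\<close> collects the constants of the two estimates below, which
    combine to \<open>g * l \<le> k * \<delta>\<close>; the tolerance \<open>g * l / k\<close> makes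
    this impossible.\<close>
  define k where "k = norm W * norm V + g"
  have k: "0 < k"
    using g by (simp add: k_def add_nonneg_pos)
  have "A \<noteq> 0"
    using l by (auto simp: l_def)
  then obtain x where x: "norm x = 1" and d: "norm (A (A x) - l *\<^sub>R x) < g * l / k"
    using symmetric_op_approx_eigenvector[OF A, of "g * l / k"] g l k unfolding l_def by auto
  define \<delta> where "\<delta> = norm (A (A x) - l *\<^sub>R x)"
  have "l * norm (V x) = norm (L (V x) - V (A (A x) - l *\<^sub>R x))"
    using l by (simp add: inter blinfun.diff_right blinfun.scaleR_right)
  also have "\<dots> \<le> norm (L (V x)) + norm (V (A (A x) - l *\<^sub>R x))"
    by (rule norm_triangle_ineq4)
  also have "\<dots> \<le> norm L * norm (V x) + norm V * \<delta>"
    unfolding \<delta>_def by (intro add_mono norm_blinfun)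
  finally have 1: "g * norm (V x) \<le> norm V * \<delta>"
    by (simp add: g_def algebra_simps)
  have "l = norm (A (A x) - (A (A x) - l *\<^sub>R x))"
    using x l by simp
  also have "\<dots> \<le> norm (A (A x)) + \<delta>"
    unfolding \<delta>_def by (rule norm_triangle_ineq4)
  also have "norm (A (A x)) \<le> norm W * norm (V x)"
    unfolding fac by (rule norm_blinfun)
  finally have "g * l \<le> g * (norm W * norm (V x) + \<delta>)"
    using g by simp
  also have "\<dots> = norm W * (g * norm (V x)) + g * \<delta>"
    by (simp add: algebra_simps)
  also have "\<dots> \<le> norm W * (norm V * \<delta>) + g * \<delta>"
    using 1 by (intro add_right_mono mult_left_mono) simp_all
  also have "\<dots> = k * \<delta>"
    by (simp add: k_def algebra_simps)
  also have "\<dots> < g * l"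
    using d k by (simp add: \<delta>_def field_simps)
  finally show False
    by simp
qed

section \<open>Log-convexity of sandwiched norms along a semigroup of symmetric operators\<close>

context
  fixes P :: "real \<Rightarrow> 'a::real_inner \<Rightarrow>\<^sub>L 'a" and H :: "'a \<Rightarrow>\<^sub>L 'a" and C :: real
  assumes symP: "\<And>s. 0 \<le> s \<Longrightarrow> symmetric_op (P s)" and symH: "symmetric_op H"
    and P_add: "\<And>s t. 0 \<le> s \<Longrightarrow> 0 \<le> t \<Longrightarrow> P (s + t) = P s o\<^sub>L P t"
    and P_0: "P 0 = id_blinfun"
    and P_bound: "\<And>s. 0 \<le> s \<Longrightarrow> s \<le> 1 \<Longrightarrow> norm (P s) \<le> C"
begin

text \<open>Let \<open>A = P c H P c\<close> with \<open>c = (a + b) / 2\<close>. As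
  \<open>P c P c = P b P a\<close>, the square \<open>A A\<close> is \<open>W V\<close> for
  \<open>V = P a H P c\<close> and \<open>W = P c H P b\<close>. As \<open>P a\<close> and
  \<open>P b\<close> commute, \<open>V W = (P a H P a) (P b H P b)\<close>, so \<open>V\<close>
  intertwines \<open>A A\<close> with this product.\<close>

lemma sandwich_norm_midpoint:
  assumes "0 \<le> a" "0 \<le> b"
  shows "(norm (P ((a + b) / 2) o\<^sub>L H o\<^sub>L P ((a + b) / 2)))\<^sup>2
    \<le> norm (P a o\<^sub>L H o\<^sub>L P a) * norm (P b o\<^sub>L H o\<^sub>L P b)"
proof -
  define c where "c = (a + b) / 2"
  have c: "0 \<le> c"
    using assms by (simp add: c_def)
  have cc: "P c (P c x) = P b (P a x)" and ab: "P a (P b x) = P b (P a x)" for x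
    using P_add[OF c c] P_add[OF assms] P_add[OF assms(2,1)]
    by (simp_all add: c_def add.commute flip: blinfun_apply_blinfun_compose)
  have "(norm (P c o\<^sub>L H o\<^sub>L P c))\<^sup>2
      \<le> norm ((P a o\<^sub>L H o\<^sub>L P a) o\<^sub>L (P b o\<^sub>L H o\<^sub>L P b))"
  proof (rule symmetric_op_norm_sq_le_intertwined)
    show "symmetric_op (P c o\<^sub>L H o\<^sub>L P c)"
      by (rule symmetric_op_sandwich[OF symP[OF c] symH])
    show "(P c o\<^sub>L H o\<^sub>L P c) ((P c o\<^sub>L H o\<^sub>L P c) x) = (P c o\<^sub>L H o\<^sub>L P b) ((P a o\<^sub>L H o\<^sub>L P c) x)" for x
      by (simp add: cc)
    show "(P a o\<^sub>L H o\<^sub>L P c) ((P c o\<^sub>L H o\<^sub>L P c) ((P c o\<^sub>L H o\<^sub>L P c) x)) =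
        ((P a o\<^sub>L H o\<^sub>L P a) o\<^sub>L (P b o\<^sub>L H o\<^sub>L P b)) ((P a o\<^sub>L H o\<^sub>L P c) x)" for x
      by (simp add: cc ab)
  qed
  also have "\<dots> \<le> norm (P a o\<^sub>L H o\<^sub>L P a) * norm (P b o\<^sub>L H o\<^sub>L P b)"
    by (rule norm_blinfun_compose)
  finally show ?thesis
    by (simp only: c_def)
qed

text \<open>\<open>D\<close> interpolates geometrically between \<open>M0\<close> and
  \<open>M1\<close>, so dividing by it preserves the midpoint inequality and leaves
  \<open>g 0 \<le> 1\<close> and \<open>g 1 \<le> 1\<close>. Each point of the unit interval is the
  midpoint of an endpoint and another point of the interval; hence the finite supremum
  \<open>G\<close> satisfies \<open>G \<le> sqrt G\<close> and is at most 1.\<close>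

lemma sandwich_norm_le_powr:
  assumes s: "0 \<le> s" "s \<le> 1"
    and M: "0 < M0" "0 < M1" "norm H \<le> M0" "norm (P 1 o\<^sub>L H o\<^sub>L P 1) \<le> M1"
  shows "norm (P s o\<^sub>L H o\<^sub>L P s) \<le> M1 powr s * M0 powr (1 - s)"
proof -
  define D where "D s = M1 powr s * M0 powr (1 - s)" for s
  define g where "g s = norm (P s o\<^sub>L H o\<^sub>L P s) / D s" for s
  have D: "0 < D s" for s
    using M by (simp add: D_def)
  have D_mid: "D ((a + b) / 2) * D ((a + b) / 2) = D a * D b" for a b
  proof -
    have "D ((a + b) / 2) * D ((a + b) / 2) =
        (M1 powr ((a + b) / 2) * M1 powr ((a + b) / 2)) *
        (M0 powr (1 - (a + b) / 2) * M0 powr (1 - (a + b) / 2))"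
      by (simp add: D_def mult_ac)
    also have "\<dots> = M1 powr (a + b) * M0 powr ((1 - a) + (1 - b))"
    proof -
      have "1 - (a + b) / 2 + (1 - (a + b) / 2) = (1 - a) + (1 - b)"
        by (simp add: field_simps)
      then show ?thesis
        by (simp only: powr_add[symmetric] field_sum_of_halves)
    qed
    finally show ?thesis
      by (simp only: D_def powr_add mult_ac)
  qed
  have g_mid: "(g ((a + b) / 2))\<^sup>2 \<le> g a * g b" if "0 \<le> a" "0 \<le> b" for a b
    using divide_right_mono[OF sandwich_norm_midpoint[OF that], of "D a * D b"] D[of a] D[of b]
    by (simp add: g_def power_divide power2_eq_square[of "D _"] D_mid)
  have g_nonneg: "0 \<le> g s" for s
    using D[of s] by (simp add: g_def)
  have g0: "g 0 \<le> 1" and g1: "g 1 \<le> 1"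
  proof -
    have "id_blinfun o\<^sub>L H o\<^sub>L id_blinfun = H"
      by (rule blinfun_eqI) simp
    then show "g 0 \<le> 1" "g 1 \<le> 1"
      using M by (simp_all add: g_def D_def P_0)
  qed
  have bdd: "bdd_above (g ` {0..1})"
  proof (rule bdd_aboveI2)
    fix t :: real
    assume t: "t \<in> {0..1}"
    \<comment> \<open>\<open>D t\<close> is a weighted geometric mean of \<open>M0\<close> and
      \<open>M1\<close>, hence at least their minimum.\<close>
    define m where "m = min M0 M1"
    have m: "0 < m"
      using M by (simp add: m_def)
    have "m = m powr t * m powr (1 - t)"
      using m by (simp add: powr_add[symmetric])
    also have "\<dots> \<le> D t"
      unfolding D_def using t m by (intro mult_mono powr_mono2) (auto simp: m_def)
    finally have Dt: "m \<le> D t" .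
    have "norm (P t o\<^sub>L H o\<^sub>L P t) \<le> norm (P t) * norm H * norm (P t)"
      by (meson mult_right_mono norm_blinfun_compose norm_ge_zero order_trans)
    moreover have C: "norm (P t) \<le> C"
      using P_bound t by simp
    then have "0 \<le> C"
      by (rule order_trans[OF norm_ge_zero])
    then have "norm (P t) * norm H * norm (P t) \<le> C * norm H * C"
      using C by (intro mult_mono) auto
    ultimately have "norm (P t o\<^sub>L H o\<^sub>L P t) \<le> C * norm H * C"
      by linarith
    then show "g t \<le> C * norm H * C / m"
      unfolding g_def using Dt m by (intro frac_le) (auto intro: order_trans[OF norm_ge_zero])
  qed
  define G where "G = Sup (g ` {0..1})"
  have G: "g t \<le> G" if "t \<in> {0..1}" for t
    unfolding G_def using that by (intro cSup_upper bdd imageI)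
  have "g t \<le> sqrt G" if t: "t \<in> {0..1}" for t
  proof (rule real_le_rsqrt, cases "t \<le> 1 / 2")
    case True
    have "(g t)\<^sup>2 \<le> g 0 * g (2 * t)"
      using g_mid[of 0 "2 * t"] t by simp
    also have "\<dots> \<le> 1 * G"
      using G[of "2 * t"] t True g0 g_nonneg by (intro mult_mono) auto
    finally show "(g t)\<^sup>2 \<le> G"
      by simp
  next
    case False
    have "(g t)\<^sup>2 \<le> g 1 * g (2 * t - 1)"
      using g_mid[of 1 "2 * t - 1"] False by simp
    also have "\<dots> \<le> 1 * G"
      using G[of "2 * t - 1"] t False g1 g_nonneg by (intro mult_mono) auto
    finally show "(g t)\<^sup>2 \<le> G"
      by simp
  qed
  then have "G \<le> sqrt G"
    unfolding G_def by (intro cSup_least) auto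
  moreover have "0 \<le> G"
    using G[of 0] g_nonneg[of 0] by simp
  ultimately have "G * G \<le> 1 * G"
    by (metis abs_of_nonneg mult_1 mult_mono real_sqrt_ge_0_iff real_sqrt_mult_self)
  then have "G \<le> 1"
    using \<open>0 \<le> G\<close> by (cases "G = 0") auto
  then have "g s \<le> 1"
    using G[of s] s by simp
  then show ?thesis
    using D[of s] by (simp add: g_def D_def)
qed

text \<open>The bounds may vanish, where division by the interpolant breaks down, so both are
  enlarged by \<open>e\<close> and \<open>e\<close> tends to 0. The limit of \<open>powr\<close> at
  base 0 uses positive exponents; the endpoints are direct, with \<open>rpow\<close> giving the
  factor 1 at exponent 0.\<close>

lemma sandwich_norm_le:
  assumes s: "0 \<le> s" "s \<le> 1"
    and w: "norm H \<le> w0" "norm (P 1 o\<^sub>L H o\<^sub>L P 1) \<le> w1"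
  shows "norm (P s o\<^sub>L H o\<^sub>L P s) \<le> rpow w1 s * rpow w0 (1 - s)"
proof -
  have w0: "0 \<le> w0" and w1: "0 \<le> w1"
    using w norm_ge_zero order_trans by blast+
  consider "s = 0" | "s = 1" | "0 < s" "s < 1"
    using s by linarith
  then show ?thesis
  proof cases
    case 3
    have "((\<lambda>e. (w1 + e) powr s * (w0 + e) powr (1 - s)) \<longlongrightarrow>
        (w1 + 0) powr s * (w0 + 0) powr (1 - s)) (at_right 0)"
      using 3 w0 w1
      by (intro tendsto_mult tendsto_powr' tendsto_add tendsto_const tendsto_ident_at)
        (auto simp: eventually_at_right_less intro!: eventually_at_right_less[THEN eventually_mono])
    moreover have "eventually (\<lambda>e. norm (P s o\<^sub>L H o\<^sub>L P s)
        \<le> (w1 + e) powr s * (w0 + e) powr (1 - s)) (at_right 0)"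
      using eventually_at_right_less[of 0]
      by (rule eventually_mono) (intro sandwich_norm_le_powr s; use w w0 w1 in linarith)
    ultimately have "norm (P s o\<^sub>L H o\<^sub>L P s) \<le> (w1 + 0) powr s * (w0 + 0) powr (1 - s)"
      by (intro tendsto_lowerbound) auto
    then show ?thesis
      using 3 by (simp add: rpow_def)
  next
    case 1
    moreover have "id_blinfun o\<^sub>L H o\<^sub>L id_blinfun = H"
      by (rule blinfun_eqI) simp
    ultimately show ?thesis
      using w w0 by (simp add: rpow_def P_0)
  qed (use w w1 in \<open>simp add: rpow_def\<close>)
qed

end

section \<open>Polynomials in an operator\<close>

lemma poly_op_eq_sum:
  assumes "degree p \<le> n"
  shows "poly_op p A = (\<Sum>i\<le>n. coeff p i *\<^sub>R (((o\<^sub>L) A ^^ i) id_blinfun))"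
  unfolding poly_op_def
  by (rule sum.mono_neutral_left) (use assms in \<open>auto simp: coeff_eq_0 not_le\<close>)

lemma poly_op_0 [simp]: "poly_op 0 A = 0"
  by (simp add: poly_op_def)

lemma poly_op_pCons: "poly_op (pCons a p) A = a *\<^sub>R id_blinfun + (A o\<^sub>L poly_op p A)"
proof -
  have "poly_op (pCons a p) A =
      (\<Sum>i\<le>Suc (degree p). coeff (pCons a p) i *\<^sub>R (((o\<^sub>L) A ^^ i) id_blinfun))"
    by (rule poly_op_eq_sum) (rule degree_pCons_le)
  also have "\<dots> = a *\<^sub>R id_blinfun + (\<Sum>i\<le>degree p. coeff p i *\<^sub>R (A o\<^sub>L ((o\<^sub>L) A ^^ i) id_blinfun))"
    by (subst sum.atMost_Suc_shift) simp
  also have "\<dots> = a *\<^sub>R id_blinfun + (A o\<^sub>L poly_op p A)"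
    by (simp add: poly_op_def bounded_bilinear.sum_right[OF bounded_bilinear_blinfun_compose]
        bounded_bilinear.scaleR_right[OF bounded_bilinear_blinfun_compose])
  finally show ?thesis .
qed

lemma poly_op_add: "poly_op (p + q) A = poly_op p A + poly_op q A"
proof -
  define n where "n = max (degree p) (degree q)"
  have "degree (p + q) \<le> n" "degree p \<le> n" "degree q \<le> n"
    by (simp_all add: n_def degree_add_le_max)
  then show ?thesis
    by (simp add: poly_op_eq_sum[of _ n] scaleR_add_left sum.distrib)
qed

lemma poly_op_smult: "poly_op (smult c p) A = c *\<^sub>R poly_op p A"
  by (simp add: poly_op_eq_sum[OF degree_smult_le] poly_op_def scaleR_sum_right)

lemma poly_op_diff: "poly_op (p - q) A = poly_op p A - poly_op q A"
  using poly_op_add[of "p - q" q A] by simp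

lemma poly_op_mult: "poly_op (p * q) A = poly_op p A o\<^sub>L poly_op q A"
  by (induction p)
    (simp_all add: poly_op_pCons poly_op_add poly_op_smult blinfun_eqI blinfun.add_left
      blinfun.scaleR_left mult_pCons_left)

lemma poly_op_const [simp]: "poly_op [:a:] A = a *\<^sub>R id_blinfun"
  by (simp add: poly_op_pCons)

lemma poly_op_X: "poly_op [:0, 1:] A = A"
  by (simp add: poly_op_pCons blinfun_eqI)

lemma poly_op_1 [simp]: "poly_op 1 A = id_blinfun"
  by (simp add: one_pCons)

text \<open>Phrased through the form instead of \<open>cadjoint A = A\<close>: this makes sense
  without completeness, forces complex linearity and passes to limits.\<close>

definition hermitian_op :: "('a::complex_inner \<Rightarrow>\<^sub>L 'a) \<Rightarrow> bool" where
  "hermitian_op A \<longleftrightarrow> (\<forall>x y. cinner (blinfun_apply A x) y = cinner x (blinfun_apply A y))"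

lemma hermitian_opD:
  "hermitian_op A \<Longrightarrow> cinner (blinfun_apply A x) y = cinner x (blinfun_apply A y)"
  by (simp add: hermitian_op_def)

lemma hermitian_op_BH: "hermitian_op A \<Longrightarrow> A \<in> BH"
  by (rule BH_if_cinner_adjoint) (rule hermitian_opD)

lemma hermitian_op_symmetric: "hermitian_op A \<Longrightarrow> symmetric_op A"
  by (simp add: symmetric_op_def inner_eq_Re_cinner hermitian_opD)

lemma hermitian_op_poly_op:
  assumes A: "hermitian_op A"
  shows "hermitian_op (poly_op p A)"
proof (induction p)
  case 0
  show ?case
    by (simp add: hermitian_op_def)
next
  case (pCons a p)
  \<comment> \<open>\<open>A\<close> commutes with \<open>poly_op p A\<close> because polynomial
    multiplication is commutative.\<close>
  have "A o\<^sub>L poly_op p A = poly_op p A o\<^sub>L A"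
    using poly_op_mult[of "[:0, 1:]" p A] poly_op_mult[of p "[:0, 1:]" A]
    by (simp only: poly_op_X mult.commute)
  then have "A (poly_op p A x) = poly_op p A (A x)" for x
    by (metis blinfun_apply_blinfun_compose)
  then show ?case
    using pCons A
    by (simp add: hermitian_op_def poly_op_pCons blinfun.add_left blinfun.scaleR_left
        cinner_add_left cinner_add_right cinner_scaleR_left cinner_scaleR_right)
qed

lemma hermitian_op_limit:
  assumes lim: "f \<longlonglongrightarrow> A" and f: "\<And>n. hermitian_op (f n)"
  shows "hermitian_op A"
  unfolding hermitian_op_def
proof (intro allI)
  fix x y
  have ap: "(\<lambda>n. f n z) \<longlonglongrightarrow> A z" for z
    by (intro blinfun.tendsto lim tendsto_const)
  have "(\<lambda>n. cinner (f n x) y) \<longlonglongrightarrow> cinner (A x) y"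
    by (rule bounded_linear.tendsto[OF bounded_linear_cinner_left ap])
  moreover have "(\<lambda>n. cinner (f n x) y) \<longlonglongrightarrow> cinner x (A y)"
    using tendsto_cnj[OF bounded_linear.tendsto[OF bounded_linear_cinner_left ap[of y], of x]]
    by (simp add: hermitian_opD[OF f] flip: cinner_commute)
  ultimately show "cinner (A x) y = cinner x (A y)"
    by (rule LIMSEQ_unique)
qed

text \<open>The form of the adjoint is the conjugate form, here equal to the form itself, so
  \<open>Z - cadjoint Z\<close> has zero form and vanishes by polarisation.\<close>

lemma positive_op_hermitian:
  fixes Z :: "'a::chilbert_space \<Rightarrow>\<^sub>L 'a"
  assumes Z: "positive_op Z"
  shows "hermitian_op Z"
proof -
  have BH: "Z \<in> BH"
    using Z by (simp add: positive_op_def)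
  have "Z + (-1) *\<^sub>R cadjoint Z = 0"
  proof (rule BH_eq_zero_if_form_zero)
    show "Z + (-1) *\<^sub>R cadjoint Z \<in> BH"
      by (intro BH_add BH_scaleR BH_cadjoint BH)
    fix x
    have "cinner (cadjoint Z x) x = cnj (cinner (Z x) x)"
      unfolding cinner_cadjoint_left[OF BH] by (rule cinner_commute)
    also have "\<dots> = cinner (Z x) x"
      using Z by (simp add: positive_op_def Reals_cnj_iff)
    finally show "cinner ((Z + (-1) *\<^sub>R cadjoint Z) x) x = 0"
      by (simp add: blinfun.diff_left cinner_diff_left)
  qed
  then have "cadjoint Z = Z"
    by simp
  then show ?thesis
    using cinner_cadjoint[OF BH] by (simp add: hermitian_op_def)
qed

lemma positive_op_inner_nonneg: "positive_op Z \<Longrightarrow> 0 \<le> inner (blinfun_apply Z x) x"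
  by (simp add: positive_op_def inner_eq_Re_cinner)

section \<open>The spectrum of a positive operator\<close>

text \<open>The equation \<open>A x = y\<close> is the fixed point equation
  \<open>x = D x + c *\<^sub>R y\<close> of a contraction. Linearity of the inverse follows from
  injectivity of \<open>A\<close>, its boundedness from the fixed point equation.\<close>

lemma ex_BH_inverse_if_near_identity:
  fixes A :: "'a::chilbert_space \<Rightarrow>\<^sub>L 'a"
  assumes A: "A \<in> BH" and c: "c \<noteq> 0" and near: "norm (id_blinfun - c *\<^sub>R A) < 1"
  shows "\<exists>B\<in>BH. \<forall>x. blinfun_apply B (A x) = x \<and> A (blinfun_apply B x) = x"
proof -
  define D where "D = id_blinfun - c *\<^sub>R A"
  have D: "D x = x - c *\<^sub>R A x" for x
    by (simp add: D_def blinfun.diff_left blinfun.scaleR_left)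
  have k: "norm D < 1"
    using near by (simp add: D_def)
  have ex1: "\<exists>!x. A x = y" for y
  proof -
    have "\<exists>!x. D x + c *\<^sub>R y = x"
    proof (rule banach_fix_type[OF norm_ge_zero k], intro allI)
      fix u v
      show "dist (D u + c *\<^sub>R y) (D v + c *\<^sub>R y) \<le> norm D * dist u v"
        using norm_blinfun[of D "u - v"] by (simp add: dist_norm blinfun.diff_right)
    qed
    moreover have "D x + c *\<^sub>R y = x \<longleftrightarrow> A x = y" for x
    proof -
      have "D x + c *\<^sub>R y = x \<longleftrightarrow> c *\<^sub>R (y - A x) = 0"
        by (simp add: D algebra_simps)
      then show ?thesis
        using c by auto
    qed
    ultimately show ?thesis
      by simp
  qed
  then obtain b where b: "\<And>y. A (b y) = y"
    by metis
  have inj: "u = v" if "A u = A v" for u v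
    using ex1 that by blast
  have bA: "b (A x) = x" for x
    by (rule inj) (rule b)
  have "bounded_linear b"
  proof (rule bounded_linear_intro)
    show "b (x + y) = b x + b y" for x y
      by (rule inj) (simp add: b blinfun.add_right)
    show "b (r *\<^sub>R x) = r *\<^sub>R b x" for r x
      by (rule inj) (simp add: b blinfun.scaleR_right)
    fix y
    have "b y = D (b y) + c *\<^sub>R y"
      by (simp add: D b)
    then have "norm (b y) \<le> norm (D (b y)) + norm (c *\<^sub>R y)"
      by (metis norm_triangle_ineq)
    also have "\<dots> \<le> norm D * norm (b y) + \<bar>c\<bar> * norm y"
      using norm_blinfun[of D "b y"] by simp
    finally show "norm (b y) \<le> norm y * (\<bar>c\<bar> / (1 - norm D))"
      using k by (simp add: field_simps)
  qed
  then have B: "blinfun_apply (Blinfun b) = b"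
    by (rule bounded_linear_Blinfun_apply)
  have "Blinfun b \<in> BH"
    unfolding BH_iff B by (intro allI, rule inj) (simp add: b BH_scaleC[OF A])
  then show ?thesis
    using b bA by (intro bexI[of _ "Blinfun b"]) (simp_all add: B)
qed

lemma real_spectrum_iff:
  "complex_of_real t \<notin> spectrum A \<longleftrightarrow>
    (\<exists>B\<in>BH. \<forall>x. blinfun_apply B (poly_op [:- t, 1:] A x) = x \<and>
      poly_op [:- t, 1:] A (blinfun_apply B x) = x)"
  by (simp add: spectrum_def poly_op_pCons blinfun.add_left blinfun.diff_left blinfun.scaleR_left
      scaleR_scaleC[symmetric])

text \<open>For \<open>t\<close> outside the interval, a suitable multiple of
  \<open>Z - t *\<^sub>R id_blinfun\<close> is within distance less than 1 of the identity, hence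
  invertible.\<close>

lemma real_spectrum_positive_op:
  fixes Z :: "'a::chilbert_space \<Rightarrow>\<^sub>L 'a"
  assumes Z: "positive_op Z" and t: "complex_of_real t \<in> spectrum Z"
  shows "0 \<le> t" "t \<le> norm Z"
proof -
  have herm: "hermitian_op Z"
    by (rule positive_op_hermitian[OF Z])
  have A: "poly_op [:- t, 1:] Z = Z - t *\<^sub>R id_blinfun"
    by (rule blinfun_eqI)
      (simp add: poly_op_pCons blinfun.add_left blinfun.diff_left blinfun.scaleR_left)
  have not_near: "\<not> norm (id_blinfun - c *\<^sub>R (Z - t *\<^sub>R id_blinfun)) < 1" if "c \<noteq> 0" for c
    using ex_BH_inverse_if_near_identity[OF hermitian_op_BH[OF hermitian_op_poly_op[OF herm]] that,
        of "[:- t, 1:]"] t real_spectrum_iff[of t Z]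
    unfolding A by blast
  show "0 \<le> t"
  proof (rule ccontr)
    assume "\<not> 0 \<le> t"
    then have t: "t < 0"
      by simp
    \<comment> \<open>This choice gives \<open>1 + c * t = c * norm Z\<close>, so the form of the
      difference from the identity lies between 0 and \<open>1 + c * t\<close> on unit vectors, and
      \<open>1 + c * t < 1\<close>.\<close>
    define c where "c = 1 / (norm Z - t)"
    have pos: "0 < norm Z - t"
      using t norm_ge_zero[of Z] by linarith
    then have c: "0 < c" "c * (norm Z - t) = 1"
      by (simp_all add: c_def)
    have form: "inner ((id_blinfun - c *\<^sub>R (Z - t *\<^sub>R id_blinfun)) x) x
        = (1 + c * t) * (norm x)\<^sup>2 - c * inner (Z x) x" for x
      by (simp add: blinfun.diff_left blinfun.add_left blinfun.scaleR_left inner_diff_left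
          inner_add_left power2_norm_eq_inner algebra_simps)
    have "norm (id_blinfun - c *\<^sub>R (Z - t *\<^sub>R id_blinfun)) \<le> 1 + c * t"
    proof (rule symmetric_op_norm_leI)
      show "symmetric_op (id_blinfun - c *\<^sub>R (Z - t *\<^sub>R id_blinfun))"
        using symmetric_opD[OF hermitian_op_symmetric[OF herm]]
        by (simp add: symmetric_op_def blinfun.diff_left blinfun.scaleR_left inner_diff_left
            inner_diff_right)
      have eq: "1 + c * t = c * norm Z"
        using c(2) by (simp add: algebra_simps)
      show "0 \<le> 1 + c * t"
        unfolding eq using c by simp
      fix x
      have "inner (Z x) x \<le> norm Z * (norm x)\<^sup>2"
        using norm_cauchy_schwarz[of "Z x" x] mult_right_mono[OF norm_blinfun[of Z x], of "norm x"]
        by (simp add: power2_eq_square mult.assoc)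
      then have "c * inner (Z x) x \<le> (1 + c * t) * (norm x)\<^sup>2"
        unfolding eq mult.assoc using c(1) by simp
      moreover have "0 \<le> c * inner (Z x) x"
        using c positive_op_inner_nonneg[OF Z] by simp
      ultimately show "\<bar>inner ((id_blinfun - c *\<^sub>R (Z - t *\<^sub>R id_blinfun)) x) x\<bar>
          \<le> (1 + c * t) * (norm x)\<^sup>2"
        unfolding form by linarith
    qed
    also have "\<dots> < 1"
      using c t by (simp add: mult_pos_neg)
    finally show False
      using not_near c by simp
  qed
  show "t \<le> norm Z"
  proof (rule ccontr)
    assume "\<not> t \<le> norm Z"
    then have t: "norm Z < t" "0 < t"
      using norm_ge_zero[of Z] by linarith+
    have "id_blinfun - (- (1 / t)) *\<^sub>R (Z - t *\<^sub>R id_blinfun) = (1 / t) *\<^sub>R Z"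
      using t by (simp add: scaleR_diff_right)
    then show False
      using not_near[of "- (1 / t)"] t by simp
  qed
qed

section \<open>Lower bounds for polynomials in an operator and the resulting norm bound\<close>

lemma not_in_spectrum_bounded_below:
  assumes "complex_of_real t \<notin> spectrum A"
  shows "\<exists>\<delta>>0. \<forall>x. \<delta> * norm x \<le> norm (poly_op [:- t, 1:] A x)"
proof -
  obtain B where B: "\<And>x. blinfun_apply B (poly_op [:- t, 1:] A x) = x"
    using assms unfolding real_spectrum_iff by blast
  \<comment> \<open>Adding 1 keeps the reciprocal positive if \<open>B = 0\<close>, which happens on
    the trivial space.\<close>
  have "inverse (norm B + 1) * norm x \<le> norm (poly_op [:- t, 1:] A x)" for x
  proof -
    have "norm x \<le> norm B * norm (poly_op [:- t, 1:] A x)"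
      using norm_blinfun[of B "poly_op [:- t, 1:] A x"] by (simp add: B)
    also have "\<dots> \<le> (norm B + 1) * norm (poly_op [:- t, 1:] A x)"
      by (intro mult_right_mono) auto
    finally show ?thesis
      by (simp add: inverse_eq_divide pos_divide_le_eq add_nonneg_pos mult.commute)
  qed
  then show ?thesis
    by (intro exI[of _ "inverse (norm B + 1)"]) (simp add: add_nonneg_pos)
qed

text \<open>Without a real root there is a nonreal complex root \<open>z\<close>, and
  \<open>d\<close> is the real quadratic with roots \<open>z\<close> and its conjugate. The
  remainder modulo \<open>d\<close> has degree below 2 and vanishes at \<open>z\<close>, hence is
  zero. The map \<open>h\<close> embeds real polynomials coefficientwise into complex ones.\<close>

lemma real_poly_factor_cases:
  fixes p :: "real poly"
  assumes "degree p \<noteq> 0"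
  obtains r q where "p = [:- r, 1:] * q"
    | a b q where "b \<noteq> 0" "p = ([:- a, 1:] * [:- a, 1:] + [:b\<^sup>2:]) * q"
proof (cases "\<exists>r. poly p r = 0")
  case True
  then show thesis
    using that(1) by (auto simp: poly_eq_0_iff_dvd dvd_def)
next
  case False
  define h where "h p = map_poly complex_of_real p" for p
  have h_add: "h (p + q) = h p + h q" for p q
    by (simp add: h_def poly_eq_iff coeff_map_poly)
  have h_smult: "h (smult a p) = smult (of_real a) (h p)" for a p
    by (simp add: h_def poly_eq_iff coeff_map_poly)
  have h_pCons: "h (pCons a p) = pCons (of_real a) (h p)" for a p
    by (simp add: h_def map_poly_pCons)
  have h_0: "h 0 = 0"
    by (simp add: h_def)
  have h_mult: "h (p * q) = h p * h q" for p q
    by (induction p) (simp_all add: h_0 h_add h_smult h_pCons mult_pCons_left)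
  have "degree (h p) \<noteq> 0"
    using assms by (simp add: h_def degree_map_poly)
  then obtain z where z: "poly (h p) z = 0"
    using fundamental_theorem_of_algebra[of "h p"] by (auto simp: constant_degree)
  have real: "poly (h p) (of_real r) = of_real (poly p r)" for r
    by (induction p) (simp_all add: h_0 h_pCons)
  have b: "Im z \<noteq> 0"
    using z False real[of "Re z"] by (metis complex_is_Real_iff of_real_Re of_real_eq_0_iff)
  define d where "d = [:- Re z, 1:] * [:- Re z, 1:] + [:(Im z)\<^sup>2:]"
  have d: "degree d = 2"
    by (simp add: d_def)
  have dz: "poly (h d) z = 0"
    by (simp add: d_def h_mult h_add h_pCons h_0 complex_eq_iff power2_eq_square)
  define r where "r = p mod d"
  have "poly (h r) z = 0"
  proof -
    have "p = p div d * d + r"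
      by (simp add: r_def)
    then have "poly (h p) z = poly (h (p div d)) z * poly (h d) z + poly (h r) z"
      by (metis h_add h_mult poly_add poly_mult)
    then show ?thesis
      using z dz by simp
  qed
  moreover have "degree r < 2"
    using degree_mod_less[of d p] d unfolding r_def by (cases "d = 0") auto
  then have r_eq: "r = [:coeff r 0, coeff r 1:]"
    by (intro poly_eqI) (auto simp: coeff_pCons coeff_eq_0 split: nat.split)
  ultimately have r: "poly (h [:coeff r 0, coeff r 1:]) z = 0"
    by simp
  then have "coeff r 1 = 0"
    using b by (auto simp: h_pCons h_0 complex_eq_iff)
  moreover from this r have "coeff r 0 = 0"
    by (simp add: h_pCons h_0)
  ultimately have "r = 0"
    using r_eq by simp
  then have "p = d * (p div d)"
    by (simp add: r_def mod_eq_0_iff_dvd)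
  then show thesis
    using that(2) b unfolding d_def by blast
qed

text \<open>Lower bounds multiply under composition, so one factor is split off at a time: a real
  root lies outside the spectrum, and a quadratic \<open>(X - a)\<^sup>2 + b\<^sup>2\<close> has
  form at least \<open>b\<^sup>2 * (norm x)\<^sup>2\<close>.\<close>

lemma poly_op_bounded_below:
  fixes A :: "'a::complex_inner \<Rightarrow>\<^sub>L 'a"
  assumes A: "hermitian_op A"
  shows "p \<noteq> 0 \<Longrightarrow> (\<And>t. complex_of_real t \<in> spectrum A \<Longrightarrow> poly p t \<noteq> 0) \<Longrightarrow>
    \<exists>\<delta>>0. \<forall>x. \<delta> * norm x \<le> norm (poly_op p A x)"
proof (induction "degree p" arbitrary: p rule: less_induct)
  case less
  have factor: ?case if p: "p = d * q" and d: "degree d \<noteq> 0"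
    and "0 < \<delta>" and \<delta>: "\<And>x. \<delta> * norm x \<le> norm (poly_op d A x)" for d q \<delta>
  proof -
    have "q \<noteq> 0" "d \<noteq> 0"
      using less.prems(1) p by auto
    then have "degree q < degree p"
      using p d by (simp add: degree_mult_eq)
    moreover have "poly q t \<noteq> 0" if "complex_of_real t \<in> spectrum A" for t
      using less.prems(2)[OF that] p by auto
    ultimately obtain e where e: "0 < e" "\<And>x. e * norm x \<le> norm (poly_op q A x)"
      using less.hyps \<open>q \<noteq> 0\<close> by blast
    have "\<delta> * e * norm x \<le> norm (poly_op p A x)" for x
    proof -
      have "\<delta> * e * norm x \<le> \<delta> * norm (poly_op q A x)"
        using mult_left_mono[OF e(2)[of x], of \<delta>] \<open>0 < \<delta>\<close> by (simp add: mult.assoc)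
      also have "\<dots> \<le> norm (poly_op d A (poly_op q A x))"
        by (rule \<delta>)
      finally show ?thesis
        by (simp add: p poly_op_mult)
    qed
    then show ?thesis
      using \<open>0 < \<delta>\<close> e(1) by (intro exI[of _ "\<delta> * e"]) simp
  qed
  show ?case
  proof (cases "degree p = 0")
    case True
    then obtain a where p: "p = [:a:]"
      by (metis degree_eq_zeroE)
    then show ?thesis
      using less.prems(1) by (intro exI[of _ "\<bar>a\<bar>"]) (simp add: blinfun.scaleR_left)
  next
    case False
    then show ?thesis
    proof (cases rule: real_poly_factor_cases)
      case (1 r q)
      then have "complex_of_real r \<notin> spectrum A"
        using less.prems(2)[of r] by auto
      then obtain \<delta> where "0 < \<delta>" "\<And>x. \<delta> * norm x \<le> norm (poly_op [:- r, 1:] A x)"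
        using not_in_spectrum_bounded_below by blast
      then show ?thesis
        by (intro factor[OF 1]) auto
    next
      case (2 a b q)
      let ?L = "poly_op [:- a, 1:] A" and ?d = "[:- a, 1:] * [:- a, 1:] + [:b\<^sup>2:]"
      have sym: "symmetric_op ?L"
        by (intro hermitian_op_symmetric hermitian_op_poly_op A)
      have "b\<^sup>2 * norm x \<le> norm (poly_op ?d A x)" for x
      proof (cases "x = 0")
        case False
        \<comment> \<open>By symmetry of \<open>?L\<close>, the form of its square at
          \<open>x\<close> is \<open>inner (?L x) (?L x)\<close>.\<close>
        have "b\<^sup>2 * (norm x)\<^sup>2 \<le> inner (?L x) (?L x) + b\<^sup>2 * (norm x)\<^sup>2"
          by simp
        also have "\<dots> = inner (poly_op ?d A x) x"
          by (simp only: poly_op_add poly_op_mult poly_op_const blinfun.add_left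
              blinfun_apply_blinfun_compose blinfun.scaleR_left blinfun_apply_id_blinfun id_apply
              inner_add_left symmetric_opD[OF sym] inner_scaleR_left power2_norm_eq_inner)
        also have "\<dots> \<le> norm (poly_op ?d A x) * norm x"
          by (rule norm_cauchy_schwarz)
        finally have "(b\<^sup>2 * norm x) * norm x \<le> norm (poly_op ?d A x) * norm x"
          by (simp add: power2_eq_square[of "norm x"] mult.assoc)
        then show ?thesis
          using False by simp
      qed (simp add: blinfun.zero_right)
      then show ?thesis
        using 2(1) by (intro factor[OF 2(2)]) auto
    qed
  qed
qed

text \<open>With empty real spectrum, \<open>A\<^sup>2 - (norm A)\<^sup>2\<close> would be bounded
  below, against the approximate eigenvectors of a nonzero \<open>A\<close>; and if
  \<open>A = 0\<close> is invertible, every vector is zero. The conclusion for arbitrary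
  \<open>x\<close> says that the space is trivial.\<close>

lemma real_spectrum_nonempty:
  fixes A :: "'a::complex_inner \<Rightarrow>\<^sub>L 'a"
  assumes A: "hermitian_op A" and empty: "\<And>t. complex_of_real t \<notin> spectrum A"
  shows "(x::'a) = 0"
proof (cases "A = 0")
  case True
  obtain B where "\<And>x. blinfun_apply B (poly_op [:- 0, 1:] A x) = x"
    using empty[of 0] unfolding real_spectrum_iff by blast
  then show ?thesis
    using True by (metis add.inverse_neutral blinfun.zero_left blinfun.zero_right poly_op_X)
next
  case False
  let ?p = "[:0, 1:] * [:0, 1:] - [:(norm A)\<^sup>2:]"
  have "?p \<noteq> 0"
    by simp
  then obtain \<delta> where \<delta>: "0 < \<delta>" "\<And>x. \<delta> * norm x \<le> norm (poly_op ?p A x)"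
    using poly_op_bounded_below[OF A] empty by blast
  obtain x where "norm x = 1" "norm (A (A x) - (norm A)\<^sup>2 *\<^sub>R x) < \<delta>"
    using symmetric_op_approx_eigenvector[OF hermitian_op_symmetric[OF A] False \<delta>(1)] by blast
  moreover have "poly_op ?p A x = A (A x) - (norm A)\<^sup>2 *\<^sub>R x"
    by (simp only: poly_op_diff poly_op_mult poly_op_const poly_op_X blinfun.diff_left
        blinfun_apply_blinfun_compose blinfun.scaleR_left blinfun_apply_id_blinfun id_apply)
  ultimately show ?thesis
    using \<delta>(2)[of x] by simp
qed

text \<open>If \<open>\<parallel>p(A)\<parallel>\<close> exceeded \<open>|p|\<close> on the spectrum, \<open>p\<^sup>2 - \<parallel>p(A)\<parallel>\<^sup>2\<close> would have no roots there, and so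
  \<open>p(A)\<^sup>2 - \<parallel>p(A)\<parallel>\<^sup>2\<close> would admit no approximate eigenvectors.\<close>

lemma norm_poly_op_le:
  fixes A :: "'a::complex_inner \<Rightarrow>\<^sub>L 'a"
  assumes A: "hermitian_op A" and c: "0 \<le> c"
    and bound: "\<And>t. complex_of_real t \<in> spectrum A \<Longrightarrow> \<bar>poly p t\<bar> \<le> c"
  shows "norm (poly_op p A) \<le> c"
proof (rule ccontr)
  define T where "T = poly_op p A"
  assume "\<not> norm (poly_op p A) \<le> c"
  then have T: "c < norm T" "T \<noteq> 0"
    using c by (auto simp: T_def)
  let ?q = "p * p - [:(norm T)\<^sup>2:]"
  have root: "poly ?q t \<noteq> 0" if "complex_of_real t \<in> spectrum A" for t
  proof
    assume "poly ?q t = 0"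
    then have "(poly p t)\<^sup>2 = (norm T)\<^sup>2"
      by (simp add: power2_eq_square)
    then have "\<bar>poly p t\<bar> = norm T"
      by (metis abs_norm_cancel power2_eq_iff abs_minus_cancel)
    then show False
      using bound[OF that] T by simp
  qed
  \<comment> \<open>A nonzero vector makes the spectrum nonempty, and \<open>?q\<close> does not
    vanish at a spectral point; thus \<open>?q\<close> is not the zero polynomial.\<close>
  obtain y where "T y \<noteq> 0"
    using T(2) by (metis blinfun_eqI zero_blinfun.rep_eq)
  then have "?q \<noteq> 0"
    using real_spectrum_nonempty[OF A, of "T y"] root by (metis poly_0)
  then obtain \<delta> where \<delta>: "0 < \<delta>" "\<And>x. \<delta> * norm x \<le> norm (poly_op ?q A x)"
    using poly_op_bounded_below[OF A] root by blast
  have "symmetric_op T"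
    unfolding T_def by (intro hermitian_op_symmetric hermitian_op_poly_op A)
  then obtain x where x: "norm x = 1" "norm (T (T x) - (norm T)\<^sup>2 *\<^sub>R x) < \<delta>"
    using symmetric_op_approx_eigenvector T(2) \<delta>(1) by blast
  have "poly_op ?q A x = T (T x) - (norm T)\<^sup>2 *\<^sub>R x"
    by (simp only: poly_op_diff poly_op_mult poly_op_const T_def[symmetric] blinfun.diff_left
        blinfun_apply_blinfun_compose blinfun.scaleR_left blinfun_apply_id_blinfun id_apply)
  then show False
    using \<delta>(2)[of x] x by simp
qed

section \<open>Functional calculus and powers\<close>

abbreviation real_spectrum :: "('a::complex_inner \<Rightarrow>\<^sub>L 'a) \<Rightarrow> real set" where
  "real_spectrum A \<equiv> {t. complex_of_real t \<in> spectrum A}"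

text \<open>Uniform closeness on the spectrum becomes norm closeness by
  \<open>norm_poly_op_le\<close>. The case \<open>q = p\<close> gives the Cauchy property, the
  general case independence of the approximating sequence.\<close>

lemma poly_op_close:
  fixes A :: "'a::complex_inner \<Rightarrow>\<^sub>L 'a"
  assumes A: "hermitian_op A"
    and p: "uniform_limit (real_spectrum A) (\<lambda>n. poly (p n)) f sequentially"
    and q: "uniform_limit (real_spectrum A) (\<lambda>n. poly (q n)) f sequentially"
    and e: "0 < e"
  shows "\<exists>N. \<forall>m\<ge>N. \<forall>n\<ge>N. norm (poly_op (p m) A - poly_op (q n) A) < e"
proof -
  have e4: "0 < e / 4"
    using e by simp
  obtain N where N: "\<And>n t. N \<le> n \<Longrightarrow> t \<in> real_spectrum A \<Longrightarrow> dist (poly (p n) t) (f t) < e / 4"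
      "\<And>n t. N \<le> n \<Longrightarrow> t \<in> real_spectrum A \<Longrightarrow> dist (poly (q n) t) (f t) < e / 4"
    using eventually_conj[OF uniform_limitD[OF p e4] uniform_limitD[OF q e4]]
    unfolding eventually_sequentially by metis
  have "norm (poly_op (p m) A - poly_op (q n) A) < e" if "N \<le> m" "N \<le> n" for m n
  proof -
    have "norm (poly_op (p m - q n) A) \<le> e / 2"
    proof (rule norm_poly_op_le[OF A])
      fix t
      assume "complex_of_real t \<in> spectrum A"
      then have "dist (poly (p m) t) (poly (q n) t) \<le> e / 2"
        using dist_triangle2[of "poly (p m) t" "poly (q n) t" "f t"]
          N(1)[OF that(1), of t] N(2)[OF that(2), of t] by simp
      then show "\<bar>poly (p m - q n) t\<bar> \<le> e / 2"
        by (simp add: dist_real_def)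
    qed (use e in simp)
    then show ?thesis
      using e by (simp add: poly_op_diff)
  qed
  then show ?thesis
    by blast
qed

text \<open>The limit exists by completeness and is common to all approximating sequences; the given
  sequence \<open>p\<close> makes the description in \<open>cfc\<close> unique.\<close>

lemma tendsto_cfc:
  fixes A :: "'a::chilbert_space \<Rightarrow>\<^sub>L 'a"
  assumes A: "hermitian_op A"
    and p: "uniform_limit (real_spectrum A) (\<lambda>n. poly (p n)) f sequentially"
  shows "(\<lambda>n. poly_op (p n) A) \<longlonglongrightarrow> cfc f A"
proof -
  have "Cauchy (\<lambda>n. poly_op (p n) A)"
    using poly_op_close[OF A p p] by (intro CauchyI) blast
  then obtain B where B: "(\<lambda>n. poly_op (p n) A) \<longlonglongrightarrow> B"
    using Cauchy_convergent_iff convergent_def by blast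
  have *: "(\<lambda>n. poly_op (q n) A) \<longlonglongrightarrow> B"
    if q: "uniform_limit (real_spectrum A) (\<lambda>n. poly (q n)) f sequentially" for q
  proof -
    have "(\<lambda>n. poly_op (p n) A - poly_op (q n) A) \<longlonglongrightarrow> 0"
      by (rule LIMSEQ_I) (use poly_op_close[OF A p q] in fastforce)
    then show ?thesis
      using tendsto_diff[OF B] by fastforce
  qed
  have "cfc f A = B"
    unfolding cfc_def
  proof (rule the_equality)
    fix C
    assume "\<forall>p. uniform_limit (real_spectrum A) (\<lambda>n. poly (p n)) f sequentially \<longrightarrow>
      (\<lambda>n. poly_op (p n) A) \<longlonglongrightarrow> C"
    then show "C = B"
      using p B LIMSEQ_unique by blast
  qed (use * in blast)
  then show ?thesis
    using B by simp
qed

lemma ex_poly_uniform_limit: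
  fixes f :: "real \<Rightarrow> real"
  assumes "compact S" "continuous_on S f"
  shows "\<exists>p. uniform_limit S (\<lambda>n. poly (p n)) f sequentially"
proof -
  have "\<exists>p. \<forall>x\<in>S. \<bar>f x - poly p x\<bar> < inverse (real (Suc n))" for n
  proof -
    obtain g where g: "real_polynomial_function g"
      "\<And>x. x \<in> S \<Longrightarrow> \<bar>f x - g x\<bar> < inverse (real (Suc n))"
      using Stone_Weierstrass_real_polynomial_function[OF assms, of "inverse (real (Suc n))"]
      by auto
    obtain a k where "g = (\<lambda>x. \<Sum>i\<le>k. a i * x ^ i)"
      using real_polynomial_function_imp_sum[OF g(1)] by blast
    then have "g x = poly (\<Sum>i\<le>k. monom (a i) i) x" for x
      by (simp add: poly_sum poly_monom)
    then show ?thesis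
      using g(2) by metis
  qed
  then obtain p where p: "\<And>n x. x \<in> S \<Longrightarrow> \<bar>f x - poly (p n) x\<bar> < inverse (real (Suc n))"
    by metis
  have "uniform_limit S (\<lambda>n. poly (p n)) f sequentially"
  proof (rule uniform_limitI)
    fix e :: real
    assume "0 < e"
    then have "eventually (\<lambda>n. inverse (real (Suc n)) < e) sequentially"
      using LIMSEQ_inverse_real_of_nat by (rule order_tendstoD(2)[rotated])
    then show "eventually (\<lambda>n. \<forall>x\<in>S. dist (poly (p n) x) (f x) < e) sequentially"
    proof (rule eventually_mono, intro ballI)
      fix n x
      assume "inverse (real (Suc n)) < e" "x \<in> S"
      then show "dist (poly (p n) x) (f x) < e"
        using p[of x n] by (simp add: dist_real_def abs_minus_commute)
    qed
  qed
  then show ?thesis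
    by blast
qed

section \<open>Real powers of a positive operator\<close>

lemma continuous_on_rpow:
  assumes "0 \<le> s"
  shows "continuous_on {0..M} (\<lambda>t. rpow t s)"
proof (cases "s = 0")
  case False
  then show ?thesis
    unfolding rpow_def using assms by (auto intro!: continuous_on_powr')
qed (simp add: rpow_def)

lemma rpow_add:
  assumes "0 \<le> s" "0 \<le> t"
  shows "rpow x (s + t) = rpow x s * rpow x t"
  using assms by (auto simp: rpow_def powr_add add_nonneg_eq_0_iff)

lemma rpow_nonneg: "0 \<le> rpow x s"
  by (simp add: rpow_def)

context
  fixes Z :: "'a::chilbert_space \<Rightarrow>\<^sub>L 'a"
  assumes Z: "positive_op Z"
begin

lemma real_spectrum_subset: "real_spectrum Z \<subseteq> {0..norm Z}"
  using real_spectrum_positive_op[OF Z] by auto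

text \<open>Weierstrass approximation is applied on the compact interval \<open>{0..norm Z}\<close>,
  which contains the real spectrum.\<close>

lemma op_rpow_approx:
  assumes "0 \<le> s"
  obtains p where "uniform_limit (real_spectrum Z) (\<lambda>n. poly (p n)) (\<lambda>t. rpow t s) sequentially"
    and "(\<lambda>n. poly_op (p n) Z) \<longlonglongrightarrow> op_rpow Z s"
proof -
  obtain p where "uniform_limit {0..norm Z} (\<lambda>n. poly (p n)) (\<lambda>t. rpow t s) sequentially"
    using ex_poly_uniform_limit[OF compact_Icc continuous_on_rpow[OF assms]] by blast
  then have p: "uniform_limit (real_spectrum Z) (\<lambda>n. poly (p n)) (\<lambda>t. rpow t s) sequentially"
    by (rule uniform_limit_on_subset) (rule real_spectrum_subset)
  then show thesis
    using that tendsto_cfc[OF positive_op_hermitian[OF Z] p] unfolding op_rpow_def by blast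
qed

lemma hermitian_op_rpow: "0 \<le> s \<Longrightarrow> hermitian_op (op_rpow Z s)"
  by (rule op_rpow_approx)
    (auto intro: hermitian_op_limit hermitian_op_poly_op positive_op_hermitian[OF Z])

lemma op_rpow_eqI:
  assumes "\<And>t. 0 \<le> t \<Longrightarrow> rpow t s = poly p t"
  shows "op_rpow Z s = poly_op p Z"
proof -
  have "uniform_limit (real_spectrum Z) (\<lambda>n. poly p) (\<lambda>t. rpow t s) sequentially"
    using assms real_spectrum_positive_op[OF Z]
    by (intro uniform_limitI always_eventually) auto
  then have "(\<lambda>n::nat. poly_op p Z) \<longlonglongrightarrow> op_rpow Z s"
    unfolding op_rpow_def by (rule tendsto_cfc[OF positive_op_hermitian[OF Z]])
  then show ?thesis
    using LIMSEQ_unique tendsto_const by blast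
qed

lemma op_rpow_0: "op_rpow Z 0 = id_blinfun"
  using op_rpow_eqI[of 0 1] by (simp add: rpow_def)

lemma op_rpow_1: "op_rpow Z 1 = Z"
  using op_rpow_eqI[of 1 "[:0, 1:]"] by (simp add: rpow_def poly_op_X)

text \<open>Products of approximating polynomials converge uniformly to the product, since both
  limit functions are bounded on the spectrum.\<close>

lemma op_rpow_add:
  assumes s: "0 \<le> s" and t: "0 \<le> t"
  shows "op_rpow Z (s + t) = op_rpow Z s o\<^sub>L op_rpow Z t"
proof -
  obtain p where p: "uniform_limit (real_spectrum Z) (\<lambda>n. poly (p n)) (\<lambda>x. rpow x s) sequentially"
    "(\<lambda>n. poly_op (p n) Z) \<longlonglongrightarrow> op_rpow Z s"
    by (rule op_rpow_approx[OF s])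
  obtain q where q: "uniform_limit (real_spectrum Z) (\<lambda>n. poly (q n)) (\<lambda>x. rpow x t) sequentially"
    "(\<lambda>n. poly_op (q n) Z) \<longlonglongrightarrow> op_rpow Z t"
    by (rule op_rpow_approx[OF t])
  have bdd: "bounded ((\<lambda>x. rpow x r) ` real_spectrum Z)" if "0 \<le> r" for r
    by (rule bounded_subset[OF compact_imp_bounded[OF
            compact_continuous_image[OF continuous_on_rpow[OF that] compact_Icc]]])
      (rule image_mono[OF real_spectrum_subset])
  have "uniform_limit (real_spectrum Z) (\<lambda>n. poly (p n * q n)) (\<lambda>x. rpow x (s + t)) sequentially"
    using uniform_lim_mult[OF p(1) q(1) bdd[OF s] bdd[OF t]]
    by (simp add: rpow_add[OF s t] poly_mult[abs_def])
  then have "(\<lambda>n. poly_op (p n * q n) Z) \<longlonglongrightarrow> op_rpow Z (s + t)"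
    unfolding op_rpow_def by (rule tendsto_cfc[OF positive_op_hermitian[OF Z]])
  moreover have "(\<lambda>n. poly_op (p n * q n) Z) \<longlonglongrightarrow> (op_rpow Z s o\<^sub>L op_rpow Z t)"
    unfolding poly_op_mult
    by (rule bounded_bilinear.tendsto[OF bounded_bilinear_blinfun_compose p(2) q(2)])
  ultimately show ?thesis
    by (rule LIMSEQ_unique)
qed

text \<open>A bound uniform in \<open>s\<close>, as the interpolation requires. One unit makes the
  base at least 1, so that \<open>powr\<close> grows with its exponent; the other absorbs the
  approximation error.\<close>

lemma norm_op_rpow_le:
  assumes s: "0 \<le> s" "s \<le> 1"
  shows "norm (op_rpow Z s) \<le> norm Z + 2"
proof -
  obtain p where p: "uniform_limit (real_spectrum Z) (\<lambda>n. poly (p n)) (\<lambda>x. rpow x s) sequentially"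
    "(\<lambda>n. poly_op (p n) Z) \<longlonglongrightarrow> op_rpow Z s"
    by (rule op_rpow_approx[OF s(1)])
  have "eventually (\<lambda>n. norm (poly_op (p n) Z) \<le> norm Z + 2) sequentially"
    using uniform_limitD[OF p(1) zero_less_one]
  proof (rule eventually_mono)
    fix n
    assume n: "\<forall>x\<in>real_spectrum Z. dist (poly (p n) x) (rpow x s) < 1"
    show "norm (poly_op (p n) Z) \<le> norm Z + 2"
    proof (rule norm_poly_op_le[OF positive_op_hermitian[OF Z]])
      fix t
      assume t: "complex_of_real t \<in> spectrum Z"
      then have t': "0 \<le> t" "t \<le> norm Z"
        using real_spectrum_positive_op[OF Z] by auto
      have "t powr s \<le> (norm Z + 1) powr s"
        using t' s by (intro powr_mono2) auto
      also have "\<dots> \<le> (norm Z + 1) powr 1"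
        using s by (intro powr_mono) auto
      finally have "rpow t s \<le> norm Z + 1"
        by (simp add: rpow_def)
      then show "\<bar>poly (p n) t\<bar> \<le> norm Z + 2"
        using n t rpow_nonneg[of t s] by (auto simp: dist_real_def)
    qed simp
  qed
  then show ?thesis
    by (intro tendsto_upperbound[OF tendsto_norm[OF p(2)]]) auto
qed

end

section \<open>The block operator defining \<open>\<Delta>\<close>\<close>

lemma block_op_apply:
  "blinfun_apply (block_op A B C D) z = (A (fst z) + B (snd z), C (fst z) + D (snd z))"
  by (simp add: block_op.rep_eq)

lemma BH_block_op:
  assumes "A \<in> BH" "B \<in> BH" "C \<in> BH" "D \<in> BH"
  shows "block_op A B C D \<in> BH"
  by (simp add: BH_iff block_op_apply scaleC_prod_def scaleC_add_right BH_scaleC[OF assms(1)]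
      BH_scaleC[OF assms(2)] BH_scaleC[OF assms(3)] BH_scaleC[OF assms(4)])

lemma norm_block_op_diag_le: "norm (block_op A 0 0 A) \<le> norm A"
proof (rule norm_blinfun_bound)
  fix z :: "'a \<times> 'a"
  have "(norm (block_op A 0 0 A z))\<^sup>2 = (norm (A (fst z)))\<^sup>2 + (norm (A (snd z)))\<^sup>2"
    by (simp add: block_op_apply norm_Pair)
  also have "\<dots> \<le> (norm A * norm (fst z))\<^sup>2 + (norm A * norm (snd z))\<^sup>2"
    by (intro add_mono power_mono norm_blinfun) auto
  also have "\<dots> = (norm A * norm z)\<^sup>2"
    by (simp add: norm_prod_def power_mult_distrib distrib_left)
  finally show "norm (block_op A 0 0 A z) \<le> norm A * norm z"
    by (rule power2_le_imp_le) simp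
qed simp

text \<open>The form sees only the second component, of norm at most 1; conversely each unit vector
  \<open>x\<close> is tested by \<open>(0, x)\<close>.\<close>

lemma num_radius_block_op_corner: "num_radius (block_op 0 0 0 G) = num_radius G"
proof (rule antisym; rule num_radius_leI)
  fix z :: "'a \<times> 'a"
  assume "norm z = 1"
  then have "norm (snd z) \<le> 1"
    using norm_snd_le[of "snd z" "fst z"] by simp
  then have "(norm (snd z))\<^sup>2 \<le> 1"
    by (simp add: power_le_one)
  then have "num_radius G * (norm (snd z))\<^sup>2 \<le> num_radius G * 1"
    by (intro mult_left_mono num_radius_nonneg)
  then show "cmod (cinner (block_op 0 0 0 G z) z) \<le> num_radius G"
    using cmod_form_le_num_radius[of G "snd z"] by (simp add: block_op_apply cinner_prod_def)
next
  fix x :: 'a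
  assume "norm x = 1"
  then show "cmod (cinner (G x) x) \<le> num_radius (block_op 0 0 0 G)"
    using cmod_form_le_num_radius[of "block_op 0 0 0 G" "(0, x)"]
    by (simp add: block_op_apply cinner_prod_def norm_Pair)
qed (rule num_radius_nonneg)+

text \<open>Decoupling the coefficients from \<open>\<rho>\<close> and \<open>\<nu>\<close> makes
  the operator linear in \<open>\<alpha>\<close> and \<open>\<beta>\<close> for fixed
  \<open>\<kappa>\<close>, which isolates the dependence on \<open>\<rho>\<close> in the
  limit.\<close>

definition Delta_op :: "real \<Rightarrow> real \<Rightarrow> real \<Rightarrow> ('a::complex_inner \<Rightarrow>\<^sub>L 'a) \<Rightarrow> ('a \<times> 'a) \<Rightarrow>\<^sub>L ('a \<times> 'a)"
  where "Delta_op \<alpha> \<beta> \<kappa> X = block_op 0 (\<alpha> *\<^sub>R X)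
    ((\<alpha> * \<kappa>) *\<^sub>R cadjoint X) (\<beta> *\<^sub>R (X + \<kappa> *\<^sub>R cadjoint X))"

lemma Delta_eq: "Delta \<rho> \<nu> X = num_radius (Delta_op (sqrt (8 / \<rho> - 4)) (2 / \<rho> - 2) (1 - 2 * \<nu>) X)"
  by (simp add: Delta_def Delta_op_def Let_def)

lemma Delta_op_decompose:
  "Delta_op \<alpha> \<beta> \<kappa> X = \<alpha> *\<^sub>R Delta_op 1 0 \<kappa> X + \<beta> *\<^sub>R Delta_op 0 1 \<kappa> X"
  by (rule blinfun_eqI)
    (simp add: Delta_op_def block_op_apply blinfun.add_left blinfun.scaleR_left scaleR_add_right)

lemma BH_Delta_op:
  fixes X :: "'a::chilbert_space \<Rightarrow>\<^sub>L 'a"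
  assumes "X \<in> BH"
  shows "Delta_op \<alpha> \<beta> \<kappa> X \<in> BH"
  unfolding Delta_op_def
  by (intro BH_block_op BH_scaleR BH_add BH_cadjoint assms) (simp add: hermitian_op_BH hermitian_op_def)

text \<open>Writing adjoints as conjugates leaves only the sesquilinear form of \<open>X\<close>,
  from which real linearity in \<open>X\<close> and the effect of sandwiching can be read
  off.\<close>

lemma Delta_op_form:
  fixes X :: "'a::chilbert_space \<Rightarrow>\<^sub>L 'a"
  assumes X: "X \<in> BH"
  shows "cinner (Delta_op \<alpha> \<beta> \<kappa> X z) z =
    of_real \<alpha> * cinner (X (snd z)) (fst z) + of_real (\<alpha> * \<kappa>) * cnj (cinner (X (snd z)) (fst z)) +
    of_real \<beta> * (cinner (X (snd z)) (snd z) + of_real \<kappa> * cnj (cinner (X (snd z)) (snd z)))"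
proof -
  have "cinner (cadjoint X x) y = cnj (cinner (X y) x)" for x y
    unfolding cinner_cadjoint_left[OF X] by (rule cinner_commute)
  then show ?thesis
    by (simp add: Delta_op_def block_op_apply cinner_prod_def blinfun.add_left blinfun.scaleR_left
        cinner_add_left cinner_scaleR_left)
qed

lemma Delta_op_form_sandwich:
  fixes X Y C :: "'a::chilbert_space \<Rightarrow>\<^sub>L 'a"
  assumes X: "X \<in> BH" and Y: "Y \<in> BH" and C: "\<And>x y. cinner (C x) y = cinner x (Y y)"
  shows "cinner (Delta_op \<alpha> \<beta> \<kappa> (C o\<^sub>L X o\<^sub>L Y) z) z =
    cinner (Delta_op \<alpha> \<beta> \<kappa> X (block_op Y 0 0 Y z)) (block_op Y 0 0 Y z)"
proof -
  have "C o\<^sub>L X o\<^sub>L Y \<in> BH"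
    by (intro BH_compose X Y BH_if_cinner_adjoint[OF C])
  then show ?thesis
    by (simp add: Delta_op_form X C block_op_apply)
qed

section \<open>The properties of the numerical radius of \<open>Delta_op\<close>\<close>

lemma num_radius_cong:
  assumes "\<And>z. cinner (blinfun_apply A z) z = cinner (blinfun_apply B z) z"
  shows "num_radius A = num_radius B"
  by (simp add: num_radius_def assms)

lemma num_radius_Delta_op_add:
  fixes X Y :: "'a::chilbert_space \<Rightarrow>\<^sub>L 'a"
  assumes "X \<in> BH" "Y \<in> BH"
  shows "num_radius (Delta_op \<alpha> \<beta> \<kappa> (X + Y))
    \<le> num_radius (Delta_op \<alpha> \<beta> \<kappa> X) + num_radius (Delta_op \<alpha> \<beta> \<kappa> Y)"
proof -
  have "num_radius (Delta_op \<alpha> \<beta> \<kappa> (X + Y)) = num_radius (Delta_op \<alpha> \<beta> \<kappa> X + Delta_op \<alpha> \<beta> \<kappa> Y)"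
    by (rule num_radius_cong)
      (simp add: blinfun.add_left cinner_add_left Delta_op_form assms BH_add algebra_simps)
  then show ?thesis
    by (simp add: num_radius_add_le)
qed

lemma num_radius_Delta_op_scaleR:
  fixes X :: "'a::chilbert_space \<Rightarrow>\<^sub>L 'a"
  assumes "X \<in> BH"
  shows "num_radius (Delta_op \<alpha> \<beta> \<kappa> (t *\<^sub>R X)) = \<bar>t\<bar> * num_radius (Delta_op \<alpha> \<beta> \<kappa> X)"
  unfolding num_radius_scaleR[symmetric]
  by (rule num_radius_cong)
    (simp add: blinfun.scaleR_left cinner_scaleR_left Delta_op_form assms BH_scaleR algebra_simps)

text \<open>The operator itself vanishes by polarisation, and its second column yields
  \<open>\<alpha> *\<^sub>R X = 0\<close> and
  \<open>\<beta> *\<^sub>R (X + \<kappa> *\<^sub>R cadjoint X) = 0\<close>. If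
  \<open>\<alpha> = 0\<close>, then \<open>X = - \<kappa> *\<^sub>R cadjoint X\<close>; using this
  twice gives \<open>X = \<kappa>\<^sup>2 *\<^sub>R X\<close>.\<close>

lemma eq_zero_if_num_radius_Delta_op_zero:
  fixes X :: "'a::chilbert_space \<Rightarrow>\<^sub>L 'a"
  assumes X: "X \<in> BH" and zero: "num_radius (Delta_op \<alpha> \<beta> \<kappa> X) = 0"
    and nondeg: "\<alpha> \<noteq> 0 \<or> \<beta> \<noteq> 0 \<and> \<kappa>\<^sup>2 \<noteq> 1"
  shows "X = 0"
proof -
  have "Delta_op \<alpha> \<beta> \<kappa> X = 0"
    using cmod_form_le_num_radius[of "Delta_op \<alpha> \<beta> \<kappa> X"] zero
    by (intro BH_eq_zero_if_form_zero BH_Delta_op X) simp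
  then have "blinfun_apply (Delta_op \<alpha> \<beta> \<kappa> X) (0, y) = 0" for y
    by simp
  then have 1: "\<alpha> *\<^sub>R X y = 0" and 2: "\<beta> *\<^sub>R (X y + \<kappa> *\<^sub>R cadjoint X y) = 0" for y
    by (simp_all add: Delta_op_def block_op_apply blinfun.add_left blinfun.scaleR_left
        blinfun.zero_right zero_prod_def)
  show ?thesis
  proof (cases "\<alpha> = 0")
    case False
    then show ?thesis
      using 1 by (intro blinfun_eqI) simp
  next
    case True
    then have X_eq: "X y = - \<kappa> *\<^sub>R cadjoint X y" for y
      using 2[of y] nondeg by (simp add: eq_neg_iff_add_eq_0)
    have "cinner (X x) y = 0" for x y
    proof -
      have "cinner (X x) y = of_real (- \<kappa>) * cinner x (X y)"
        by (subst X_eq) (simp only: cinner_scaleR_left cinner_cadjoint_left[OF X])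
      also have "cinner x (X y) = of_real (- \<kappa>) * cinner (X x) y"
        by (subst X_eq) (simp only: cinner_scaleR_right cinner_cadjoint[OF X])
      finally have "of_real (1 - \<kappa>\<^sup>2) * cinner (X x) y = 0"
        by (simp add: power2_eq_square algebra_simps)
      then show ?thesis
        using True nondeg by (metis eq_iff_diff_eq_0 mult_eq_0_iff of_real_eq_0_iff)
    qed
    then show ?thesis
      by (intro blinfun_eqI, intro cinner_left_ext[where 'a = 'a]) simp
  qed
qed

lemma num_radius_Delta_op_sandwich:
  fixes X Y :: "'a::chilbert_space \<Rightarrow>\<^sub>L 'a"
  assumes X: "X \<in> BH" and Y: "Y \<in> BH"
  shows "num_radius (Delta_op \<alpha> \<beta> \<kappa> (cadjoint Y o\<^sub>L X o\<^sub>L Y))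
    \<le> (norm Y)\<^sup>2 * num_radius (Delta_op \<alpha> \<beta> \<kappa> X)"
proof (rule num_radius_leI)
  fix z :: "'a \<times> 'a"
  assume z: "norm z = 1"
  define u where "u = block_op Y 0 0 Y z"
  have "norm u \<le> norm (block_op Y 0 0 Y)"
    using norm_blinfun[of "block_op Y 0 0 Y" z] z by (simp add: u_def)
  also have "\<dots> \<le> norm Y"
    by (rule norm_block_op_diag_le)
  finally have u: "(norm u)\<^sup>2 \<le> (norm Y)\<^sup>2"
    by (simp add: power_mono)
  have "cmod (cinner (Delta_op \<alpha> \<beta> \<kappa> (cadjoint Y o\<^sub>L X o\<^sub>L Y) z) z)
      = cmod (cinner (Delta_op \<alpha> \<beta> \<kappa> X u) u)"
    unfolding u_def by (simp only: Delta_op_form_sandwich[OF X Y cinner_cadjoint_left[OF Y]])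
  also have "\<dots> \<le> num_radius (Delta_op \<alpha> \<beta> \<kappa> X) * (norm u)\<^sup>2"
    by (rule cmod_form_le_num_radius)
  also have "\<dots> \<le> num_radius (Delta_op \<alpha> \<beta> \<kappa> X) * (norm Y)\<^sup>2"
    by (intro mult_left_mono u num_radius_nonneg)
  finally show "cmod (cinner (Delta_op \<alpha> \<beta> \<kappa> (cadjoint Y o\<^sub>L X o\<^sub>L Y) z) z)
      \<le> (norm Y)\<^sup>2 * num_radius (Delta_op \<alpha> \<beta> \<kappa> X)"
    by (simp only: mult.commute)
qed (simp add: num_radius_nonneg)

lemma norm_le_1_if_isometry:
  fixes U :: "'a::chilbert_space \<Rightarrow>\<^sub>L 'a"
  assumes U: "U \<in> BH" and iso: "cadjoint U o\<^sub>L U = id_blinfun"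
  shows "norm U \<le> 1"
proof (rule norm_blinfun_bound)
  fix x
  have "cinner (U x) (U x) = cinner x ((cadjoint U o\<^sub>L U) x)"
    by (simp add: cinner_cadjoint[OF U])
  then have "(norm (U x))\<^sup>2 = (norm x)\<^sup>2"
    unfolding iso by (simp only: blinfun_apply_id_blinfun id_apply cinner_same of_real_eq_iff)
  then show "norm (U x) \<le> 1 * norm x"
    by simp
qed simp

text \<open>The sandwich bound with a contraction gives one inequality; sandwiching the result with
  \<open>cadjoint U\<close> recovers \<open>X\<close> and gives the other.\<close>

lemma num_radius_Delta_op_unitary:
  fixes X U :: "'a::chilbert_space \<Rightarrow>\<^sub>L 'a"
  assumes X: "X \<in> BH" and U: "unitary_op U"
  shows "num_radius (Delta_op \<alpha> \<beta> \<kappa> (cadjoint U o\<^sub>L X o\<^sub>L U)) = num_radius (Delta_op \<alpha> \<beta> \<kappa> X)"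
proof (rule antisym)
  have U': "U \<in> BH" "cadjoint U o\<^sub>L U = id_blinfun" "U o\<^sub>L cadjoint U = id_blinfun"
    using U by (auto simp: unitary_op_def)
  have le: "num_radius (Delta_op \<alpha> \<beta> \<kappa> (cadjoint V o\<^sub>L W o\<^sub>L V)) \<le> num_radius (Delta_op \<alpha> \<beta> \<kappa> W)"
    if V: "V \<in> BH" "cadjoint V o\<^sub>L V = id_blinfun" and W: "W \<in> BH" for V W :: "'a \<Rightarrow>\<^sub>L 'a"
  proof -
    have "(norm V)\<^sup>2 \<le> 1"
      using norm_le_1_if_isometry[OF V] by (simp add: power_le_one)
    then have "(norm V)\<^sup>2 * num_radius (Delta_op \<alpha> \<beta> \<kappa> W) \<le> 1 * num_radius (Delta_op \<alpha> \<beta> \<kappa> W)"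
      by (intro mult_right_mono num_radius_nonneg)
    then show ?thesis
      using num_radius_Delta_op_sandwich[OF W V(1), of \<alpha> \<beta> \<kappa>] by linarith
  qed
  show "num_radius (Delta_op \<alpha> \<beta> \<kappa> (cadjoint U o\<^sub>L X o\<^sub>L U)) \<le> num_radius (Delta_op \<alpha> \<beta> \<kappa> X)"
    by (rule le[OF U'(1,2) X])
  have UU: "U (cadjoint U x) = x" for x
    using U'(3) by (metis blinfun_apply_blinfun_compose blinfun_apply_id_blinfun id_apply)
  have "cadjoint (cadjoint U) o\<^sub>L (cadjoint U o\<^sub>L X o\<^sub>L U) o\<^sub>L cadjoint U = X"
    by (rule blinfun_eqI) (simp add: cadjoint_cadjoint[OF U'(1)] UU)
  then show "num_radius (Delta_op \<alpha> \<beta> \<kappa> X) \<le> num_radius (Delta_op \<alpha> \<beta> \<kappa> (cadjoint U o\<^sub>L X o\<^sub>L U))"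
    using le[of "cadjoint U" "cadjoint U o\<^sub>L X o\<^sub>L U"] U' X
    by (simp add: BH_cadjoint BH_compose cadjoint_cadjoint)
qed

text \<open>Half the sum of \<open>A\<close> and its real adjoint has the same quadratic form as
  \<open>A\<close>.\<close>

lemma ex_symmetric_part:
  fixes A :: "'a::{real_inner, complete_space} \<Rightarrow>\<^sub>L 'a"
  shows "\<exists>H. symmetric_op H \<and> (\<forall>x. inner (blinfun_apply H x) x = inner (A x) x)"
proof -
  obtain B :: "'a \<Rightarrow>\<^sub>L 'a" where B: "\<And>x y. inner (A x) y = inner x (B y)"
    using ex_real_adjoint by blast
  have B': "inner (B x) y = inner x (A y)" for x y
    by (metis B inner_commute)
  have "symmetric_op ((1/2) *\<^sub>R (A + B))"
    by (simp add: symmetric_op_def blinfun.add_left blinfun.scaleR_left inner_add_left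
        inner_add_right B B')
  moreover have "inner (((1/2) *\<^sub>R (A + B)) x) x = inner (A x) x" for x
    by (simp add: blinfun.add_left blinfun.scaleR_left inner_add_left B' inner_commute[of "A x"])
  ultimately show ?thesis
    by blast
qed

text \<open>For a unit vector \<open>z\<close> choose \<open>\<omega>\<close> so that \<open>\<omega>\<close> rotates the value of the form at \<open>z\<close> onto the
  positive axis.  Taking the symmetric part of \<open>\<omega> T\<close> commutes with \<open>T \<mapsto> P T P\<close> for symmetric \<open>P\<close>,
  so the claim reduces to the norm inequality for symmetric operators.\<close>

lemma num_radius_Delta_op_op_rpow:
  fixes X Z :: "'a::chilbert_space \<Rightarrow>\<^sub>L 'a"
  assumes X: "X \<in> BH" and Z: "positive_op Z" and s: "0 \<le> s" "s \<le> 1"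
  shows "num_radius (Delta_op \<alpha> \<beta> \<kappa> (op_rpow Z s o\<^sub>L X o\<^sub>L op_rpow Z s))
    \<le> rpow (num_radius (Delta_op \<alpha> \<beta> \<kappa> (Z o\<^sub>L X o\<^sub>L Z))) s *
      rpow (num_radius (Delta_op \<alpha> \<beta> \<kappa> X)) (1 - s)"
proof (rule num_radius_leI)
  fix z :: "'a \<times> 'a"
  assume z: "norm z = 1"
  define P where "P t = block_op (op_rpow Z t) 0 0 (op_rpow Z t)" for t
  define T where "T = Delta_op \<alpha> \<beta> \<kappa> X"
  define T' where "T' t = Delta_op \<alpha> \<beta> \<kappa> (op_rpow Z t o\<^sub>L X o\<^sub>L op_rpow Z t)" for t
  have form: "cinner (T' t u) u = cinner (T (P t u)) (P t u)" if "0 \<le> t" for t u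
    unfolding T_def T'_def P_def
    by (rule Delta_op_form_sandwich[OF X])
      (use hermitian_op_rpow[OF Z that] in \<open>simp_all add: hermitian_op_BH hermitian_opD\<close>)
  obtain \<omega> where \<omega>: "cmod \<omega> = 1" "\<omega> * cinner (T' s z) z = of_real (cmod (cinner (T' s z) z))"
    using ex_unit_rotation by blast
  \<comment> \<open>The rotated operator is regarded as merely real-linear; the form of
    \<open>H\<close> is the real part of the rotated complex form.\<close>
  obtain H where H: "symmetric_op H"
    "\<And>u. inner (blinfun_apply H u) u = inner ((Blinfun ((*\<^sub>C) \<omega>) o\<^sub>L T) u) u"
    using ex_symmetric_part by blast
  have H_form: "inner (H u) u = Re (\<omega> * cinner (T u) u)" for u
    unfolding H(2) by (simp add: bounded_linear_Blinfun_apply bounded_linear_scaleC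
        inner_eq_Re_cinner cinner_scaleC_left)
  have symP: "symmetric_op (P t)" if "0 \<le> t" for t
    using symmetric_opD[OF hermitian_op_symmetric[OF hermitian_op_rpow[OF Z that]]]
    by (simp add: symmetric_op_def P_def block_op_apply inner_prod_def)
  have PHP_form: "inner ((P t o\<^sub>L H o\<^sub>L P t) u) u = Re (\<omega> * cinner (T' t u) u)" if "0 \<le> t" for t u
    by (simp add: symmetric_opD[OF symP[OF that]] H_form form[OF that])
  have le: "\<bar>Re (\<omega> * cinner (A u) u)\<bar> \<le> num_radius A * (norm u)\<^sup>2" for A :: "('a \<times> 'a) \<Rightarrow>\<^sub>L ('a \<times> 'a)" and u
    using cmod_form_le_num_radius[of A u] abs_Re_le_cmod[of "\<omega> * cinner (A u) u"] \<omega>(1)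
    by (simp add: norm_mult)
  \<comment> \<open>For symmetric operators the form controls the norm, so bounds by numerical radii
    become norm bounds.\<close>
  have w0: "norm H \<le> num_radius T"
    by (rule symmetric_op_norm_leI[OF H(1) num_radius_nonneg]) (simp only: H_form le)
  have "symmetric_op (P 1 o\<^sub>L H o\<^sub>L P 1)"
    by (rule symmetric_op_sandwich[OF symP[OF zero_le_one] H(1)])
  then have w1: "norm (P 1 o\<^sub>L H o\<^sub>L P 1) \<le> num_radius (T' 1)"
    by (rule symmetric_op_norm_leI[OF _ num_radius_nonneg]) (simp only: PHP_form[OF zero_le_one] le)
  have "norm (P s o\<^sub>L H o\<^sub>L P s) \<le> rpow (num_radius (T' 1)) s * rpow (num_radius T) (1 - s)"
  proof (rule sandwich_norm_le[where P = P and C = "norm Z + 2"])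
    show "P (a + b) = P a o\<^sub>L P b" if "0 \<le> a" "0 \<le> b" for a b
      by (rule blinfun_eqI) (simp add: P_def block_op_apply op_rpow_add[OF Z that])
    show "P 0 = id_blinfun"
      by (rule blinfun_eqI) (simp add: P_def block_op_apply op_rpow_0[OF Z])
    show "norm (P t) \<le> norm Z + 2" if "0 \<le> t" "t \<le> 1" for t
      unfolding P_def by (rule order_trans[OF norm_block_op_diag_le norm_op_rpow_le[OF Z that]])
  qed (use symP H(1) s w0 w1 in auto)
  moreover have "cmod (cinner (T' s z) z) \<le> norm (P s o\<^sub>L H o\<^sub>L P s)"
  proof -
    \<comment> \<open>By the choice of \<open>\<omega>\<close>, taking the real part loses nothing
      at \<open>z\<close>.\<close>
    have "cmod (cinner (T' s z) z) = inner ((P s o\<^sub>L H o\<^sub>L P s) z) z"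
      unfolding PHP_form[OF s(1)] \<omega>(2) by simp
    also have "\<dots> \<le> norm ((P s o\<^sub>L H o\<^sub>L P s) z) * norm z"
      by (rule norm_cauchy_schwarz)
    also have "\<dots> \<le> norm (P s o\<^sub>L H o\<^sub>L P s)"
      using norm_blinfun[of "P s o\<^sub>L H o\<^sub>L P s" z] z by simp
    finally show ?thesis .
  qed
  ultimately show "cmod (cinner (Delta_op \<alpha> \<beta> \<kappa> (op_rpow Z s o\<^sub>L X o\<^sub>L op_rpow Z s) z) z)
    \<le> rpow (num_radius (Delta_op \<alpha> \<beta> \<kappa> (Z o\<^sub>L X o\<^sub>L Z))) s *
      rpow (num_radius (Delta_op \<alpha> \<beta> \<kappa> X)) (1 - s)"
    by (simp add: T_def T'_def op_rpow_1[OF Z])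
qed (simp add: rpow_nonneg)

text \<open>Moving \<open>r\<close> into the numerical radius turns the singular coefficients into
  \<open>sqrt (8 * r - 4 * r\<^sup>2)\<close> and \<open>2 - 2 * r\<close>. These tend to 0 and 2,
  which leaves the lower right corner.\<close>

lemma tendsto_mult_Delta:
  "((\<lambda>r. r * Delta r \<nu> X) \<longlongrightarrow> 2 * num_radius (X + (1 - 2 * \<nu>) *\<^sub>R cadjoint X))
    (at 0 within {0<..2})"
proof -
  define E where "E a b = Delta_op a b (1 - 2 * \<nu>) X" for a b
  have eq: "r * Delta r \<nu> X
      = num_radius (sqrt (8 * r - 4 * r\<^sup>2) *\<^sub>R E 1 0 + (2 - 2 * r) *\<^sub>R E 0 1)" if r: "0 < r" for r
  proof -
    have "r * sqrt (8 / r - 4) = sqrt (r\<^sup>2 * (8 / r - 4))"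
      using r by (simp only: real_sqrt_mult real_sqrt_abs abs_of_pos)
    also have "r\<^sup>2 * (8 / r - 4) = 8 * r - 4 * r\<^sup>2"
      using r by (simp add: field_simps power2_eq_square)
    finally have a: "r * sqrt (8 / r - 4) = sqrt (8 * r - 4 * r\<^sup>2)" .
    have b: "r * (2 / r - 2) = 2 - 2 * r"
      using r by (simp add: field_simps)
    have "r * Delta r \<nu> X = num_radius (r *\<^sub>R E (sqrt (8 / r - 4)) (2 / r - 2))"
      using r by (simp add: Delta_eq E_def num_radius_scaleR)
    also have "r *\<^sub>R E (sqrt (8 / r - 4)) (2 / r - 2)
        = sqrt (8 * r - 4 * r\<^sup>2) *\<^sub>R E 1 0 + (2 - 2 * r) *\<^sub>R E 0 1"
      unfolding E_def by (subst Delta_op_decompose) (simp only: scaleR_add_right scaleR_scaleR a b)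
    finally show ?thesis .
  qed
  have "((\<lambda>r. num_radius (sqrt (8 * r - 4 * r\<^sup>2) *\<^sub>R E 1 0 + (2 - 2 * r) *\<^sub>R E 0 1)) \<longlongrightarrow>
      num_radius (sqrt (8 * 0 - 4 * 0\<^sup>2) *\<^sub>R E 1 0 + (2 - 2 * 0) *\<^sub>R E 0 1)) (at 0 within {0<..2})"
    by (intro tendsto_num_radius tendsto_intros)
  also have "num_radius (sqrt (8 * 0 - 4 * 0\<^sup>2) *\<^sub>R E 1 0 + (2 - 2 * 0) *\<^sub>R E 0 1)
      = 2 * num_radius (X + (1 - 2 * \<nu>) *\<^sub>R cadjoint X)"
    by (simp add: num_radius_scaleR E_def Delta_op_def num_radius_block_op_corner)
  finally show ?thesis
    by (rule Lim_transform_within[OF _ zero_less_one]) (simp add: eq)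
qed

theorem theorem2p6:
  fixes \<rho> \<nu> :: real and X Y Z :: "'a::chilbert_space \<Rightarrow>\<^sub>L 'a"
  assumes "0 < \<rho>" "\<rho> \<le> 2" and "0 \<le> \<nu>" "\<nu> \<le> 1"
    and "X \<in> BH" "Y \<in> BH" "Z \<in> BH" and "positive_op Z"
  shows "Delta \<rho> \<nu> (X + Y) \<le> Delta \<rho> \<nu> X + Delta \<rho> \<nu> Y \<and>
    (\<forall>t::real. Delta \<rho> \<nu> (t *\<^sub>R X) = \<bar>t\<bar> * Delta \<rho> \<nu> X) \<and>
    (\<not> (\<rho> = 2 \<and> (\<nu> = 0 \<or> \<nu> = 1)) \<longrightarrow> X \<noteq> 0 \<longrightarrow> Delta \<rho> \<nu> X > 0) \<and>
    (\<forall>U. unitary_op U \<longrightarrow> Delta \<rho> \<nu> (cadjoint U o\<^sub>L X o\<^sub>L U) = Delta \<rho> \<nu> X) \<and>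
    Delta \<rho> \<nu> (cadjoint Y o\<^sub>L X o\<^sub>L Y) \<le> (norm Y)\<^sup>2 * Delta \<rho> \<nu> X \<and>
    (\<forall>s\<in>{0..1}. Delta \<rho> \<nu> (op_rpow Z s o\<^sub>L X o\<^sub>L op_rpow Z s)
       \<le> rpow (Delta \<rho> \<nu> (Z o\<^sub>L X o\<^sub>L Z)) s * rpow (Delta \<rho> \<nu> X) (1 - s)) \<and>
    ((\<lambda>r. r * Delta r \<nu> X) \<longlongrightarrow> 2 * num_radius (X + (1 - 2 * \<nu>) *\<^sub>R cadjoint X))
      (at 0 within {0<..2})"
proof (intro conjI allI impI ballI)
  note X = \<open>X \<in> BH\<close> and Y = \<open>Y \<in> BH\<close>
  show "Delta \<rho> \<nu> (X + Y) \<le> Delta \<rho> \<nu> X + Delta \<rho> \<nu> Y"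
    unfolding Delta_eq by (rule num_radius_Delta_op_add[OF X Y])
  show "Delta \<rho> \<nu> (t *\<^sub>R X) = \<bar>t\<bar> * Delta \<rho> \<nu> X" for t
    unfolding Delta_eq by (rule num_radius_Delta_op_scaleR[OF X])
  show "Delta \<rho> \<nu> X > 0" if nondeg: "\<not> (\<rho> = 2 \<and> (\<nu> = 0 \<or> \<nu> = 1))" and "X \<noteq> 0"
  proof -
    \<comment> \<open>\<open>\<alpha>\<close> vanishes just at \<open>\<rho> = 2\<close>; there
      \<open>\<beta> = -1\<close>, and \<open>(1 - 2 * \<nu>)\<^sup>2 = 1\<close> holds exactly for
      the excluded values of \<open>\<nu>\<close>.\<close>
    have "sqrt (8 / \<rho> - 4) \<noteq> 0" if "\<rho> \<noteq> 2"
      using that \<open>0 < \<rho>\<close> by (simp add: field_simps)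
    moreover have "(1 - 2 * \<nu>)\<^sup>2 \<noteq> 1" if "\<rho> = 2"
      using that nondeg by (auto simp: power2_eq_1_iff)
    moreover have "2 / \<rho> - 2 \<noteq> 0" if "\<rho> = 2"
      using that by simp
    ultimately have "Delta \<rho> \<nu> X \<noteq> 0"
      using eq_zero_if_num_radius_Delta_op_zero[OF X, of "sqrt (8 / \<rho> - 4)" "2 / \<rho> - 2" "1 - 2 * \<nu>"]
        \<open>X \<noteq> 0\<close> unfolding Delta_eq by blast
    then show ?thesis
      using num_radius_nonneg unfolding Delta_eq by (simp add: order_less_le)
  qed
  show "Delta \<rho> \<nu> (cadjoint U o\<^sub>L X o\<^sub>L U) = Delta \<rho> \<nu> X" if "unitary_op U" for U
    unfolding Delta_eq by (rule num_radius_Delta_op_unitary[OF X that])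
  show "Delta \<rho> \<nu> (cadjoint Y o\<^sub>L X o\<^sub>L Y) \<le> (norm Y)\<^sup>2 * Delta \<rho> \<nu> X"
    unfolding Delta_eq by (rule num_radius_Delta_op_sandwich[OF X Y])
  show "Delta \<rho> \<nu> (op_rpow Z s o\<^sub>L X o\<^sub>L op_rpow Z s)
      \<le> rpow (Delta \<rho> \<nu> (Z o\<^sub>L X o\<^sub>L Z)) s * rpow (Delta \<rho> \<nu> X) (1 - s)" if "s \<in> {0..1}" for s
    unfolding Delta_eq
    by (rule num_radius_Delta_op_op_rpow[OF X \<open>positive_op Z\<close>]) (use that in auto)
qed (rule tendsto_mult_Delta)

end
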